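(* Let $0<a<2$, $d\in\mathbb N$ and $s>2a$. Let $A=(-\Delta)^{a/2}$ on $L^2(\mathbb R^d)$ and let $f\in H^s(\mathbb R^d)$. Then for a.e. $x\in\mathbb R^d$, the function $\mathbb R\to\mathbb C$, $t\mapsto\exp(itA)f(x)$, is continuous. In particular, $\exp(itA)f(x)\to f(x)$ as $t\to0$ for a.e. $x\in\mathbb R^d$.
   Context: $\Delta$ is the Laplacian on $\mathbb R^d$, so $(-\Delta)^{a/2}$ is the Fourier multiplier operator with symbol $|\xi|^a$ (up to the normalization of the Fourier transform), and $\exp(itA)$ is the unitary group on $L^2(\mathbb R^d)$ given by the self-adjoint functional calculus. $H^s(\mathbb R^d)=\{f\in L^2(\mathbb R^d):(1+|\xi|^2)^{s/2}\hat f\in L^2(\mathbb R^d)\}$. The a.e. continuity statement means that for each $t$ one can choose a representative of $\exp(itA)f\in L^2(\mathbb R^d)$ such that for a.e. $x$ the function $t\mapsto\exp(itA)f(x)$ is continuous on $\mathbb R$. *)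

theory Defs
  imports "HOL-Analysis.Analysis"
begin

text \<open>
  Elements of \<open>L\<^sup>2\<close> are represented by square-integrable Borel functions; two functions represent the
  same element iff they agree almost everywhere.  Unbounded operators on \<open>L\<^sup>2\<close> are given by their
  graphs, which contain all representatives of the elements involved.
\<close>

definition L2 :: "('a::euclidean_space \<Rightarrow> complex) set" where
  "L2 = {f \<in> borel_measurable lborel. integrable lborel (\<lambda>x. (cmod (f x))\<^sup>2)}"

definition L2_inner :: "('a::euclidean_space \<Rightarrow> complex) \<Rightarrow> ('a \<Rightarrow> complex) \<Rightarrow> complex" where
  "L2_inner f g = (LINT x|lborel. f x * cnj (g x))"

definition L2_norm :: "('a::euclidean_space \<Rightarrow> complex) \<Rightarrow> real" where
  "L2_norm f = sqrt (LINT x|lborel. (cmod (f x))\<^sup>2)"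

type_synonym 'a L2_operator = "(('a \<Rightarrow> complex) \<times> ('a \<Rightarrow> complex)) set"


subsection \<open>Fourier transform, Sobolev spaces, Fourier multipliers\<close>

text \<open>The unitary normalization, for which \<open>-\<Delta>\<close> has symbol exactly \<open>|\<xi>|\<^sup>2\<close>.\<close>

definition fourier_integral :: "('a::euclidean_space \<Rightarrow> complex) \<Rightarrow> 'a \<Rightarrow> complex" where
  "fourier_integral f \<xi> =
     complex_of_real ((2 * pi) powr (- (real DIM('a) / 2))) *
     (LINT x|lborel. exp (- \<i> * complex_of_real (\<xi> \<bullet> x)) * f x)"

text \<open>
  The graph of the Fourier transform on \<open>L\<^sup>2\<close>: the extension by continuity of the Fourier integral
  from \<open>L\<^sup>1 \<inter> L\<^sup>2\<close>.
\<close>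

definition L2_fourier :: "'a::euclidean_space L2_operator" where
  "L2_fourier = {(f, g). f \<in> L2 \<and> g \<in> L2 \<and>
     (\<exists>\<phi> :: nat \<Rightarrow> 'a \<Rightarrow> complex.
        (\<forall>n. \<phi> n \<in> L2 \<and> integrable lborel (\<phi> n) \<and> fourier_integral (\<phi> n) \<in> L2) \<and>
        (\<lambda>n. L2_norm (\<lambda>x. \<phi> n x - f x)) \<longlonglongrightarrow> 0 \<and>
        (\<lambda>n. L2_norm (\<lambda>\<xi>. fourier_integral (\<phi> n) \<xi> - g \<xi>)) \<longlonglongrightarrow> 0)}"

definition sobolev :: "real \<Rightarrow> ('a::euclidean_space \<Rightarrow> complex) set" where
  "sobolev s = {f \<in> L2. \<exists>g. (f, g) \<in> L2_fourier \<and>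
     (\<lambda>\<xi>. complex_of_real ((1 + (norm \<xi>)\<^sup>2) powr (s / 2)) * g \<xi>) \<in> L2}"

text \<open>With its maximal domain: \<open>f\<close> is in the domain iff the product of \<open>m\<close> and the transform of
  \<open>f\<close> is in \<open>L\<^sup>2\<close>.\<close>

definition fourier_multiplier :: "('a::euclidean_space \<Rightarrow> complex) \<Rightarrow> 'a L2_operator" where
  "fourier_multiplier m = {(f, g). \<exists>F. (f, F) \<in> L2_fourier \<and> (g, \<lambda>\<xi>. m \<xi> * F \<xi>) \<in> L2_fourier}"

text \<open>\<open>frac_laplacian a\<close> is \<open>(-\<Delta>)\<close> to the power \<open>a/2\<close>.\<close>

definition frac_laplacian :: "real \<Rightarrow> 'a::euclidean_space L2_operator" where
  "frac_laplacian a = fourier_multiplier (\<lambda>\<xi>. complex_of_real (norm \<xi> powr a))"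


subsection \<open>Functional calculus of self-adjoint operators\<close>

text \<open>An everywhere defined symmetric map is automatically linear and compatible with almost
  everywhere equality.\<close>

definition L2_projection :: "(('a::euclidean_space \<Rightarrow> complex) \<Rightarrow> ('a \<Rightarrow> complex)) \<Rightarrow> bool" where
  "L2_projection P \<longleftrightarrow>
     (\<forall>f\<in>L2. P f \<in> L2 \<and> (AE x in lborel. P (P f) x = P f x)) \<and>
     (\<forall>f\<in>L2. \<forall>g\<in>L2. L2_inner (P f) g = L2_inner f (P g))"

definition projection_valued_measure ::
    "(real set \<Rightarrow> ('a::euclidean_space \<Rightarrow> complex) \<Rightarrow> ('a \<Rightarrow> complex)) \<Rightarrow> bool" where
  "projection_valued_measure E \<longleftrightarrow>
     (\<forall>B\<in>sets borel. L2_projection (E B)) \<and>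
     (\<forall>f\<in>L2. AE x in lborel. E UNIV f x = f x) \<and>
     (\<forall>B\<in>sets borel. \<forall>C\<in>sets borel. \<forall>f\<in>L2. AE x in lborel. E (B \<inter> C) f x = E B (E C f) x) \<and>
     (\<forall>B :: nat \<Rightarrow> real set. range B \<subseteq> sets borel \<longrightarrow> disjoint_family B \<longrightarrow>
        (\<forall>f\<in>L2. (\<lambda>n. L2_norm (\<lambda>x. (\<Sum>i<n. E (B i) f x) - E (\<Union>i. B i) f x)) \<longlonglongrightarrow> 0))"

definition scalar_spectral_measure ::
    "(real set \<Rightarrow> ('a::euclidean_space \<Rightarrow> complex) \<Rightarrow> ('a \<Rightarrow> complex)) \<Rightarrow> ('a \<Rightarrow> complex) \<Rightarrow> real measure" where
  "scalar_spectral_measure E f =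
     measure_of UNIV (sets borel) (\<lambda>B. ennreal (Re (L2_inner (E B f) f)))"

text \<open>
  The operator \<open>\<integral> \<phi> dE\<close>.  For fixed \<open>f\<close>, the map sending a simple function \<open>\<Sum> c 1\<^bsub>B\<^esub>\<close> to
  \<open>\<Sum> c E(B) f\<close> is an isometry from \<open>L\<^sup>2(\<mu>)\<close> to \<open>L\<^sup>2\<close>, where \<open>\<mu>\<close> is the scalar spectral measure
  of \<open>f\<close>; the integral is its extension by continuity.  The domain consists of those \<open>f\<close> with
  \<open>\<phi> \<in> L\<^sup>2(\<mu>)\<close>, which the convergence of simple functions to \<open>\<phi>\<close> enforces.
\<close>

definition spectral_integral ::
    "(real set \<Rightarrow> ('a::euclidean_space \<Rightarrow> complex) \<Rightarrow> ('a \<Rightarrow> complex)) \<Rightarrow> (real \<Rightarrow> complex) \<Rightarrow> 'a L2_operator" where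
  "spectral_integral E \<phi> = {(f, g). f \<in> L2 \<and> g \<in> L2 \<and>
     (\<exists>\<sigma> :: nat \<Rightarrow> real \<Rightarrow> complex.
        (\<forall>n. simple_function borel (\<sigma> n)) \<and>
        (\<lambda>n. \<integral>\<^sup>+l. ennreal ((cmod (\<sigma> n l - \<phi> l))\<^sup>2) \<partial>scalar_spectral_measure E f) \<longlonglongrightarrow> 0 \<and>
        (\<lambda>n. L2_norm (\<lambda>x. (\<Sum>c\<in>range (\<sigma> n). c * E (\<sigma> n -` {c}) f x) - g x)) \<longlonglongrightarrow> 0)}"

text \<open>
  By the spectral theorem, \<open>A\<close> has a representation \<open>A = \<integral> l dE(l)\<close> iff it is self-adjoint, and
  then \<open>E\<close> is unique (up to almost everywhere equality), so that the existential quantifier over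
  \<open>E\<close> involves no choice.
\<close>

definition functional_calculus ::
    "(real \<Rightarrow> complex) \<Rightarrow> 'a::euclidean_space L2_operator \<Rightarrow> 'a L2_operator" where
  "functional_calculus \<phi> A = {(f, g). \<exists>E. projection_valued_measure E \<and>
     A = spectral_integral E complex_of_real \<and> (f, g) \<in> spectral_integral E \<phi>}"

definition unitary_group :: "'a::euclidean_space L2_operator \<Rightarrow> real \<Rightarrow> 'a L2_operator" where
  "unitary_group A t = functional_calculus (\<lambda>l. exp (\<i> * complex_of_real (t * l))) A"

end

(* The Fourier transform is unitary on L2: on bounded continuous integrable functions this is
   Plancherel's identity, obtained by Gaussian summation from the multiplication formula, and such
   functions are dense.  Hence A is unitarily equivalent to multiplication by m = |xi|^a, its spectral
   measure is multiplication by the indicators of m^-1(B), and exp(itA) is multiplication by exp(itm).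
   For s > 2a, a function f in H^s lies in the domain of A^2, so that the components f_k of f with
   frequencies in {k <= m < k + 1} satisfy ||f_k|| <= C / (1 + k)^2.  In
     exp(itA) f = sum over k, j of exp(itk) (it)^j / j! (A - k)^j f_k
   the functions on the right do not depend on t, and the L2 norms are summable locally uniformly in t;
   hence for almost every x the series converges absolutely, locally uniformly in t, to a continuous
   function of t. *)

theory Submission
  imports Defs "HOL-Probability.Characteristic_Functions"
begin

subsection \<open>The space of square-integrable functions\<close>

text \<open>For each single t the functional calculus determines exp(itA) f only up to a null set,
  and uncountably many null sets may cover everything. The obstacle is to choose representatives for
  all t at once; this is why t has to be separated from x in the series. Expanding exp(itA) f
  directly in powers of A would separate them too, but needs f in the domain of every power of A.
  Cutting the spectrum into unit intervals first leaves |m - k| < 1 on each piece, so that the j-th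
  term costs only |t|^j / j!, uniformly in k, while k itself enters t only through a phase of
  modulus 1. Summable norms say more than convergence in L2: by monotone convergence they give
  absolute convergence at almost every point. Operators on L2 are graphs containing all
  representatives, and A must equal its spectral integral as a set. Hence the care taken on the
  Fourier side: domains and changes on null sets have to match in both directions.\<close>

lemma L2_measurable: "f \<in> L2 \<Longrightarrow> f \<in> borel_measurable borel"
  by (simp add: L2_def)

lemma L2_integrable_square: "f \<in> L2 \<Longrightarrow> integrable lborel (\<lambda>x. (cmod (f x))\<^sup>2)"
  by (simp add: L2_def)

lemma L2_I:
  "f \<in> borel_measurable borel \<Longrightarrow> integrable lborel (\<lambda>x. (cmod (f x))\<^sup>2) \<Longrightarrow> f \<in> L2"
  by (simp add: L2_def)

lemma L2_norm_nonneg [simp]: "0 \<le> L2_norm f"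
  by (simp add: L2_norm_def)

lemma L2_norm_square: "(L2_norm f)\<^sup>2 = (LINT x|lborel. (cmod (f x))\<^sup>2)"
  by (simp add: L2_norm_def)

lemma nn_integral_L2_norm:
  "f \<in> L2 \<Longrightarrow> (\<integral>\<^sup>+x. ennreal ((cmod (f x))\<^sup>2) \<partial>lborel) = ennreal ((L2_norm f)\<^sup>2)"
  by (simp add: L2_norm_square nn_integral_eq_integral L2_integrable_square)

lemma L2_nn_integralI:
  assumes "f \<in> borel_measurable borel" "(\<integral>\<^sup>+x. ennreal ((cmod (f x))\<^sup>2) \<partial>lborel) < \<infinity>"
  shows "f \<in> L2"
  using assms by (intro L2_I integrableI_bounded) auto

lemma L2_norm_cong_AE:
  assumes "AE x in lborel. f x = g x"
    and "f \<in> borel_measurable borel" "g \<in> borel_measurable borel"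
  shows "L2_norm f = L2_norm g"
  unfolding L2_norm_def using assms by (intro arg_cong[of _ _ sqrt] integral_cong_AE) auto

lemma L2_bound:
  assumes "w \<in> L2" "f \<in> borel_measurable borel" "AE x in lborel. cmod (f x) \<le> C * cmod (w x)"
  shows "f \<in> L2"
proof (rule L2_I)
  have "AE x in lborel. norm ((cmod (f x))\<^sup>2) \<le> norm (C\<^sup>2 * (cmod (w x))\<^sup>2)"
    using assms(3) by eventually_elim (simp add: power_mono power_mult_distrib[symmetric])
  then show "integrable lborel (\<lambda>x. (cmod (f x))\<^sup>2)"
    by (rule Bochner_Integration.integrable_bound[rotated 2])
      (use assms(1,2) in \<open>simp_all add: L2_integrable_square\<close>)
qed fact

lemma L2_norm_bound:
  assumes "w \<in> L2" "f \<in> borel_measurable borel" "AE x in lborel. cmod (f x) \<le> C * cmod (w x)"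
    and "0 \<le> C"
  shows "L2_norm f \<le> C * L2_norm w"
proof -
  have f: "f \<in> L2" by (rule L2_bound[OF assms(1-3)])
  have "AE x in lborel. (cmod (f x))\<^sup>2 \<le> C\<^sup>2 * (cmod (w x))\<^sup>2"
    using assms(3) by eventually_elim (simp add: power_mono power_mult_distrib[symmetric])
  then have "(L2_norm f)\<^sup>2 \<le> (C * L2_norm w)\<^sup>2"
    unfolding L2_norm_square power_mult_distrib Bochner_Integration.integral_mult_right_zero[symmetric]
    by (intro integral_mono_AE) (auto intro!: L2_integrable_square f assms)
  then show ?thesis using assms(4) by (simp add: power2_le_iff_abs_le)
qed

lemma L2_zero [simp]: "(\<lambda>x. 0) \<in> L2"
  by (simp add: L2_def)

lemma L2_norm_zero [simp]: "L2_norm (\<lambda>x. 0) = 0"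
  by (simp add: L2_norm_def)

lemma L2_mult_bounded:
  assumes "f \<in> L2" "m \<in> borel_measurable borel" "\<And>x. cmod (m x) \<le> C"
  shows "(\<lambda>x. m x * f x) \<in> L2"
proof (rule L2_bound[OF assms(1), where C = C])
  show "(\<lambda>x. m x * f x) \<in> borel_measurable borel"
    using L2_measurable[OF assms(1)] assms(2) by measurable
qed (use assms in \<open>simp add: norm_mult mult_right_mono\<close>)

lemma L2_scale: "f \<in> L2 \<Longrightarrow> (\<lambda>x. c * f x) \<in> L2"
  using L2_mult_bounded[of f "\<lambda>_. c" "cmod c"] by simp

lemma borel_measurable_cnj [measurable (raw)]:
  "f \<in> borel_measurable M \<Longrightarrow> (\<lambda>x. cnj (f x)) \<in> borel_measurable M"
  by (rule borel_measurable_continuous_on[OF continuous_on_cnj[OF continuous_on_id]])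

lemma L2_cnj: "f \<in> L2 \<Longrightarrow> (\<lambda>x. cnj (f x)) \<in> L2"
  using borel_measurable_cnj[OF L2_measurable, of f] by (simp add: L2_def)

lemma L2_norm_scale: "L2_norm (\<lambda>x. c * f x) = cmod c * L2_norm f"
  by (simp add: L2_norm_def norm_mult power_mult_distrib real_sqrt_mult)

lemma L2_norm_minus_commute: "L2_norm (\<lambda>x. f x - g x) = L2_norm (\<lambda>x. g x - f x)"
  by (simp add: L2_norm_def norm_minus_commute)

lemma L2_add:
  assumes "f \<in> L2" "g \<in> L2"
  shows "(\<lambda>x. f x + g x) \<in> L2"
proof (rule L2_I)
  show "(\<lambda>x. f x + g x) \<in> borel_measurable borel" using assms[THEN L2_measurable] by measurable
  have "AE x in lborel. norm ((cmod (f x + g x))\<^sup>2) \<le> norm (2 * (cmod (f x))\<^sup>2 + 2 * (cmod (g x))\<^sup>2)"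
  proof (rule AE_I2)
    fix x
    have "(cmod (f x + g x))\<^sup>2 \<le> (cmod (f x) + cmod (g x))\<^sup>2"
      by (intro power_mono norm_triangle_ineq) auto
    also have "\<dots> \<le> 2 * (cmod (f x))\<^sup>2 + 2 * (cmod (g x))\<^sup>2"
      using sum_squares_bound[of "cmod (f x)" "cmod (g x)"] by (simp add: power2_sum)
    finally show "norm ((cmod (f x + g x))\<^sup>2) \<le> norm (2 * (cmod (f x))\<^sup>2 + 2 * (cmod (g x))\<^sup>2)"
      by simp
  qed
  then show "integrable lborel (\<lambda>x. (cmod (f x + g x))\<^sup>2)"
    by (rule Bochner_Integration.integrable_bound[rotated 2])
      (use assms assms[THEN L2_measurable] in \<open>simp_all add: L2_integrable_square\<close>)
qed

lemma L2_diff: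
  assumes "f \<in> L2" "g \<in> L2"
  shows "(\<lambda>x. f x - g x) \<in> L2"
  using L2_add[OF assms(1) L2_scale[OF assms(2), of "-1"]] by simp

lemma L2_sum:
  "(\<And>i. i \<in> I \<Longrightarrow> h i \<in> L2) \<Longrightarrow> (\<lambda>x. \<Sum>i\<in>I. h i x) \<in> L2"
  by (induction I rule: infinite_finite_induct) (auto intro: L2_add)

lemma L2_integrable_mult:
  assumes "f \<in> L2" "g \<in> L2"
  shows "integrable lborel (\<lambda>x. f x * g x)"
proof (rule Bochner_Integration.integrable_bound)
  show "integrable lborel (\<lambda>x. (cmod (f x))\<^sup>2 + (cmod (g x))\<^sup>2)"
    using assms by (intro Bochner_Integration.integrable_add L2_integrable_square)
  show "(\<lambda>x. f x * g x) \<in> borel_measurable lborel" using assms[THEN L2_measurable] by measurable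
  have "cmod (f x) * cmod (g x) \<le> (cmod (f x))\<^sup>2 + (cmod (g x))\<^sup>2" for x
    using sum_squares_bound[of "cmod (f x)" "cmod (g x)"] mult_nonneg_nonneg[of "cmod (f x)" "cmod (g x)"]
    by (simp del: mult_nonneg_nonneg)
  then show "AE x in lborel. norm (f x * g x) \<le> norm ((cmod (f x))\<^sup>2 + (cmod (g x))\<^sup>2)"
    by (simp add: norm_mult)
qed

lemma L2_norm_eq_0_iff:
  assumes "f \<in> L2"
  shows "L2_norm f = 0 \<longleftrightarrow> (AE x in lborel. f x = 0)"
  using integral_nonneg_eq_0_iff_AE[OF L2_integrable_square[OF assms]]
  by (simp add: L2_norm_def)

lemma L2_Cauchy_Schwarz:
  assumes "f \<in> L2" "g \<in> L2"
  shows "(LINT x|lborel. cmod (f x) * cmod (g x)) \<le> L2_norm f * L2_norm g"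
proof -
  let ?a = "L2_norm f" and ?b = "L2_norm g"
  have int: "integrable lborel (\<lambda>x. cmod (f x) * cmod (g x))"
    using integrable_norm[OF L2_integrable_mult[OF assms]] by (simp add: norm_mult)
  show ?thesis
  proof (cases "?a = 0 \<or> ?b = 0")
    case True
    then have "AE x in lborel. cmod (f x) * cmod (g x) = 0"
      using assms by (auto simp: L2_norm_eq_0_iff)
    then have "(LINT x|lborel. cmod (f x) * cmod (g x)) = 0"
      by (rule integral_eq_zero_AE)
    then show ?thesis by simp
  next
    case False
    then have ab: "0 < ?a" "0 < ?b"
      using L2_norm_nonneg[of f] L2_norm_nonneg[of g] by linarith+
    \<comment> \<open>Young's inequality with weights that balance the two terms: after integration
      each contributes \<open>?a * ?b\<close>. The weights divide by the norms, whence the separate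
      case above.\<close>
    have "2 * (cmod (f x) * cmod (g x)) \<le> ?b / ?a * (cmod (f x))\<^sup>2 + ?a / ?b * (cmod (g x))\<^sup>2" for x
    proof -
      have "0 \<le> (?b * cmod (f x) - ?a * cmod (g x))\<^sup>2 / (?a * ?b)" using ab by simp
      also have "\<dots> = ?b / ?a * (cmod (f x))\<^sup>2 + ?a / ?b * (cmod (g x))\<^sup>2 - 2 * (cmod (f x) * cmod (g x))"
        using ab by (simp add: field_simps power2_eq_square)
      finally show ?thesis by simp
    qed
    then have "(LINT x|lborel. 2 * (cmod (f x) * cmod (g x)))
        \<le> (LINT x|lborel. ?b / ?a * (cmod (f x))\<^sup>2 + ?a / ?b * (cmod (g x))\<^sup>2)"
      using assms int
      by (intro integral_mono integrable_mult_right Bochner_Integration.integrable_add L2_integrable_square)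
    also have "\<dots> = ?b / ?a * ?a\<^sup>2 + ?a / ?b * ?b\<^sup>2"
      using assms by (simp add: L2_norm_square L2_integrable_square)
    also have "\<dots> = 2 * (?a * ?b)" using ab by (simp add: power2_eq_square)
    finally show ?thesis using int by simp
  qed
qed

lemma L2_norm_triangle:
  assumes "f \<in> L2" "g \<in> L2"
  shows "L2_norm (\<lambda>x. f x + g x) \<le> L2_norm f + L2_norm g"
proof (rule power2_le_imp_le)
  have int: "integrable lborel (\<lambda>x. cmod (f x) * cmod (g x))"
    using integrable_norm[OF L2_integrable_mult[OF assms]] by (simp add: norm_mult)
  have "(L2_norm (\<lambda>x. f x + g x))\<^sup>2
      \<le> (LINT x|lborel. (cmod (f x))\<^sup>2 + 2 * (cmod (f x) * cmod (g x)) + (cmod (g x))\<^sup>2)"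
    unfolding L2_norm_square
  proof (rule integral_mono)
    fix x
    have "(cmod (f x + g x))\<^sup>2 \<le> (cmod (f x) + cmod (g x))\<^sup>2"
      by (intro power_mono norm_triangle_ineq) auto
    then show "(cmod (f x + g x))\<^sup>2
        \<le> (cmod (f x))\<^sup>2 + 2 * (cmod (f x) * cmod (g x)) + (cmod (g x))\<^sup>2"
      by (simp add: power2_sum)
  qed (use assms int in \<open>intro integrable_mult_right Bochner_Integration.integrable_add
      L2_integrable_square L2_add; simp\<close>)+
  also have "\<dots> = (L2_norm f)\<^sup>2 + 2 * (LINT x|lborel. cmod (f x) * cmod (g x)) + (L2_norm g)\<^sup>2"
    using assms int by (simp add: L2_norm_square L2_integrable_square)
  also have "\<dots> \<le> (L2_norm f + L2_norm g)\<^sup>2"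
    using L2_Cauchy_Schwarz[OF assms] by (simp add: power2_sum)
  finally show "(L2_norm (\<lambda>x. f x + g x))\<^sup>2 \<le> (L2_norm f + L2_norm g)\<^sup>2" .
qed simp

lemma L2_norm_triangle_diff:
  assumes "f \<in> L2" "g \<in> L2" "h \<in> L2"
  shows "L2_norm (\<lambda>x. f x - h x) \<le> L2_norm (\<lambda>x. f x - g x) + L2_norm (\<lambda>x. g x - h x)"
  using L2_norm_triangle[OF L2_diff[OF assms(1,2)] L2_diff[OF assms(2,3)]] by simp

lemma L2_norm_sum:
  assumes "\<And>i. i \<in> I \<Longrightarrow> h i \<in> L2"
  shows "L2_norm (\<lambda>x. \<Sum>i\<in>I. h i x) \<le> (\<Sum>i\<in>I. L2_norm (h i))"
  using assms
proof (induction I rule: infinite_finite_induct)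
  case (insert i I)
  have "L2_norm (\<lambda>x. h i x + (\<Sum>i\<in>I. h i x)) \<le> L2_norm (h i) + L2_norm (\<lambda>x. \<Sum>i\<in>I. h i x)"
    by (intro L2_norm_triangle L2_sum insert.prems) auto
  also have "\<dots> \<le> L2_norm (h i) + (\<Sum>i\<in>I. L2_norm (h i))"
    by (intro add_left_mono insert.IH insert.prems) auto
  finally show ?case using insert.hyps by simp
qed simp_all

section \<open>Limits in L2, dominated convergence and series\<close>

lemma L2_norm_tendsto:
  assumes "\<And>n. s n \<in> L2" "f \<in> L2" "(\<lambda>n. L2_norm (\<lambda>x. s n x - f x)) \<longlonglongrightarrow> 0"
  shows "(\<lambda>n. L2_norm (s n)) \<longlonglongrightarrow> L2_norm f"
proof (rule LIM_zero_cancel, rule Lim_null_comparison[OF _ assms(3)])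
  have "\<bar>L2_norm (s n) - L2_norm f\<bar> \<le> L2_norm (\<lambda>x. s n x - f x)" for n
    using L2_norm_triangle_diff[OF assms(1)[of n] assms(2) L2_zero]
      L2_norm_triangle_diff[OF assms(2) assms(1)[of n] L2_zero]
    by (simp add: L2_norm_minus_commute[of f])
  then show "\<forall>\<^sub>F n in sequentially. norm (L2_norm (s n) - L2_norm f) \<le> L2_norm (\<lambda>x. s n x - f x)"
    by simp
qed

lemma L2_limit_unique:
  assumes "\<And>n. s n \<in> L2" "f \<in> L2" "g \<in> L2"
    and "(\<lambda>n. L2_norm (\<lambda>x. s n x - f x)) \<longlonglongrightarrow> 0" "(\<lambda>n. L2_norm (\<lambda>x. s n x - g x)) \<longlonglongrightarrow> 0"
  shows "AE x in lborel. f x = g x"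
proof -
  have "(\<lambda>n. L2_norm (\<lambda>x. s n x - f x) + L2_norm (\<lambda>x. s n x - g x)) \<longlonglongrightarrow> 0"
    using tendsto_add[OF assms(4,5)] by simp
  moreover have "L2_norm (\<lambda>x. f x - g x) \<le> L2_norm (\<lambda>x. s n x - f x) + L2_norm (\<lambda>x. s n x - g x)" for n
    using L2_norm_triangle_diff[OF assms(2) assms(1)[of n] assms(3)]
    by (simp add: L2_norm_minus_commute[of f])
  ultimately have "L2_norm (\<lambda>x. f x - g x) \<le> 0"
    by (intro tendsto_lowerbound) auto
  then have "L2_norm (\<lambda>x. f x - g x) = 0"
    using L2_norm_nonneg[of "\<lambda>x. f x - g x"] by linarith
  then show ?thesis
    using L2_norm_eq_0_iff[OF L2_diff[OF assms(2,3)]] by simp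
qed

lemma L2_dominated_convergence:
  assumes w: "w \<in> L2" and s: "\<And>n. s n \<in> borel_measurable borel" and f: "f \<in> borel_measurable borel"
    and lim: "AE x in lborel. (\<lambda>n. s n x) \<longlonglongrightarrow> f x"
    and bound: "AE x in lborel. \<forall>n. cmod (s n x) \<le> C * cmod (w x)"
  shows "f \<in> L2" "\<And>n. s n \<in> L2" "(\<lambda>n. L2_norm (\<lambda>x. s n x - f x)) \<longlonglongrightarrow> 0"
proof -
  have [measurable]: "w \<in> borel_measurable borel" using w by (rule L2_measurable)
  note [measurable] = s f
  show s': "s n \<in> L2" for n
    by (rule L2_bound[OF w s]) (use bound in auto)
  \<comment> \<open>The bound passes to the limit f, so |s n - f| is at most 2 C |w|, whose square
    is an integrable majorant.\<close>
  have fb: "AE x in lborel. cmod (f x) \<le> C * cmod (w x)"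
    using lim bound
  proof eventually_elim
    case (elim x)
    show ?case by (rule tendsto_upperbound[OF tendsto_norm[OF elim(1)]]) (use elim in auto)
  qed
  show f': "f \<in> L2"
    by (rule L2_bound[OF w f fb])
  have "(\<lambda>n. LINT x|lborel. (cmod (s n x - f x))\<^sup>2) \<longlonglongrightarrow> (LINT x|(lborel :: 'a measure). 0)"
  proof (rule integral_dominated_convergence)
    show "integrable lborel (\<lambda>x. (2 * C)\<^sup>2 * (cmod (w x))\<^sup>2)"
      using w by (simp add: L2_integrable_square)
    show "AE x in lborel. (\<lambda>n. (cmod (s n x - f x))\<^sup>2) \<longlonglongrightarrow> 0"
      using lim
    proof eventually_elim
      case (elim x)
      then have "(\<lambda>n. (cmod (s n x - f x))\<^sup>2) \<longlonglongrightarrow> (cmod (f x - f x))\<^sup>2"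
        by (intro tendsto_intros)
      then show ?case by simp
    qed
    show "AE x in lborel. norm ((cmod (s n x - f x))\<^sup>2) \<le> (2 * C)\<^sup>2 * (cmod (w x))\<^sup>2" for n
      using bound fb
    proof eventually_elim
      case (elim x)
      have "cmod (s n x - f x) \<le> 2 * C * cmod (w x)"
        using norm_triangle_ineq4[of "s n x" "f x"] elim(1)[rule_format, of n] elim(2) by simp
      then have "(cmod (s n x - f x))\<^sup>2 \<le> (2 * C * cmod (w x))\<^sup>2"
        by (intro power_mono) auto
      then show ?case by (simp add: power_mult_distrib)
    qed
  qed auto
  then show "(\<lambda>n. L2_norm (\<lambda>x. s n x - f x)) \<longlonglongrightarrow> 0"
    unfolding L2_norm_def using tendsto_real_sqrt[of _ 0 sequentially] by simp
qed

text \<open>This is also the form in which completeness of \<open>L\<^sup>2\<close> is used.\<close>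

lemma L2_series:
  fixes h :: "nat \<Rightarrow> 'a::euclidean_space \<Rightarrow> complex"
  assumes h: "\<And>n. h n \<in> L2" and sum: "summable (\<lambda>n. L2_norm (h n))"
  shows "AE x in lborel. summable (\<lambda>n. cmod (h n x))"
    and "(\<lambda>x. \<Sum>n. h n x) \<in> L2"
    and "(\<lambda>N. L2_norm (\<lambda>x. (\<Sum>n<N. h n x) - (\<Sum>n. h n x))) \<longlonglongrightarrow> 0"
proof -
  have [measurable]: "h n \<in> borel_measurable borel" for n by (rule L2_measurable[OF h])
  define M where "M = (\<Sum>n. L2_norm (h n))"
  \<comment> \<open>Partial sums of the moduli, viewed as complex functions so that the L2 lemmas
    apply; by the triangle inequality their norms stay below M.\<close>
  define S where "S = (\<lambda>N x. complex_of_real (\<Sum>n<N. cmod (h n x)))"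
  have S: "S N \<in> L2" for N
    unfolding S_def of_real_sum by (intro L2_sum L2_bound[OF h, where C = 1]) auto
  have normS: "L2_norm (S N) \<le> M" for N
  proof -
    have "L2_norm (S N) \<le> (\<Sum>n<N. L2_norm (\<lambda>x. complex_of_real (cmod (h n x))))"
      unfolding S_def of_real_sum by (intro L2_norm_sum L2_bound[OF h, where C = 1]) auto
    also have "\<dots> = (\<Sum>n<N. L2_norm (h n))" by (simp add: L2_norm_def)
    also have "\<dots> \<le> M" unfolding M_def using sum by (intro sum_le_suminf) auto
    finally show ?thesis .
  qed
  have cS: "cmod (S N x) = (\<Sum>n<N. cmod (h n x))" for N x
    unfolding S_def norm_of_real by (simp add: sum_nonneg)
  have incS: "incseq (\<lambda>N. ennreal ((cmod (S N x))\<^sup>2))" for x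
    unfolding cS by (intro incseq_SucI ennreal_leI power_mono) (auto simp: sum_nonneg)
  have [measurable]: "S N \<in> borel_measurable borel" for N by (rule L2_measurable[OF S])
  \<comment> \<open>The squared partial sums increase, so monotone convergence bounds the integral
    of their supremum by M^2. The supremum is then finite almost everywhere, which is absolute
    convergence.\<close>
  define H where "H = (\<lambda>x. SUP N. ennreal ((cmod (S N x))\<^sup>2))"
  have "(\<integral>\<^sup>+x. H x \<partial>lborel) = (SUP N. \<integral>\<^sup>+x. ennreal ((cmod (S N x))\<^sup>2) \<partial>lborel)"
    unfolding H_def
    by (rule nn_integral_monotone_convergence_SUP) (use incS in \<open>auto simp: incseq_def le_fun_def\<close>)
  also have "\<dots> \<le> ennreal (M\<^sup>2)"
    by (intro SUP_least) (auto simp: nn_integral_L2_norm[OF S] intro!: ennreal_leI power_mono normS)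
  finally have H: "(\<integral>\<^sup>+x. H x \<partial>lborel) \<le> ennreal (M\<^sup>2)" .
  have [measurable]: "H \<in> borel_measurable borel" unfolding H_def by measurable
  have "AE x in lborel. H x \<noteq> \<infinity>"
    by (rule nn_integral_PInf_AE) (use H in \<open>auto simp: top_unique\<close>)
  then show ae: "AE x in lborel. summable (\<lambda>n. cmod (h n x))"
  proof eventually_elim
    case (elim x)
    then obtain B where B: "H x = ennreal B" "0 \<le> B"
      by (cases "H x") auto
    have "(\<Sum>n<N. cmod (h n x)) \<le> sqrt B" for N
    proof -
      have "ennreal ((cmod (S N x))\<^sup>2) \<le> ennreal B"
        unfolding B(1)[symmetric] H_def by (rule SUP_upper) simp
      then have "(cmod (S N x))\<^sup>2 \<le> B" using B(2) by simp
      then show ?thesis unfolding cS[symmetric] by (rule real_le_rsqrt)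
    qed
    then show ?case by (intro summableI_nonneg_bounded) auto
  qed
  \<comment> \<open>The full sum of the moduli is the L2 majorant of all partial sums of the series
    itself.\<close>
  define G where "G = (\<lambda>x. complex_of_real (\<Sum>n. cmod (h n x)))"
  have [measurable]: "G \<in> borel_measurable borel" unfolding G_def by measurable
  have "G \<in> L2"
  proof (rule L2_nn_integralI)
    have "AE x in lborel. ennreal ((cmod (G x))\<^sup>2) \<le> H x"
      using ae
    proof eventually_elim
      case (elim x)
      have "(\<lambda>N. ennreal ((cmod (S N x))\<^sup>2)) \<longlonglongrightarrow> ennreal ((cmod (G x))\<^sup>2)"
        unfolding cS G_def norm_of_real using summable_LIMSEQ[OF elim] suminf_nonneg[OF elim]
        by (intro tendsto_intros) simp
      then show ?case unfolding H_def
        using LIMSEQ_unique[OF _ LIMSEQ_SUP[OF incS]] by (simp add: eq_refl)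
    qed
    then have "(\<integral>\<^sup>+x. ennreal ((cmod (G x))\<^sup>2) \<partial>lborel) \<le> (\<integral>\<^sup>+x. H x \<partial>lborel)"
      by (rule nn_integral_mono_AE)
    also note H
    finally show "(\<integral>\<^sup>+x. ennreal ((cmod (G x))\<^sup>2) \<partial>lborel) < \<infinity>"
      using le_less_trans[OF _ ennreal_less_top] by auto
  qed measurable
  have lim: "AE x in lborel. (\<lambda>N. \<Sum>n<N. h n x) \<longlonglongrightarrow> (\<Sum>n. h n x)"
    using ae by eventually_elim (intro summable_LIMSEQ, rule summable_norm_cancel)
  have bound: "AE x in lborel. \<forall>N. cmod (\<Sum>n<N. h n x) \<le> 1 * cmod (G x)"
    using ae
  proof eventually_elim
    case (elim x)
    show ?case
    proof
      fix N
      have "cmod (\<Sum>n<N. h n x) \<le> (\<Sum>n<N. cmod (h n x))" by (rule norm_sum)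
      also have "\<dots> \<le> (\<Sum>n. cmod (h n x))" using elim by (intro sum_le_suminf) auto
      finally show "cmod (\<Sum>n<N. h n x) \<le> 1 * cmod (G x)" by (simp add: G_def)
    qed
  qed
  show "(\<lambda>x. \<Sum>n. h n x) \<in> L2"
    "(\<lambda>N. L2_norm (\<lambda>x. (\<Sum>n<N. h n x) - (\<Sum>n. h n x))) \<longlonglongrightarrow> 0"
    by (rule L2_dominated_convergence[OF \<open>G \<in> L2\<close> _ _ lim bound]; measurable)+
qed

section \<open>Inner product and polarization\<close>

lemma L2_inner_self: "L2_inner f f = complex_of_real ((L2_norm f)\<^sup>2)"
  unfolding L2_inner_def L2_norm_square by (simp add: complex_norm_square[symmetric] of_real_power[symmetric] del: of_real_power)

lemma L2_inner_scale_left: "L2_inner (\<lambda>x. c * f x) g = c * L2_inner f g"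
  by (simp add: L2_inner_def mult.assoc)

lemma L2_inner_scale_right: "L2_inner f (\<lambda>x. c * g x) = cnj c * L2_inner f g"
  by (simp add: L2_inner_def mult.left_commute)

lemma L2_inner_add_left:
  assumes "f \<in> L2" "g \<in> L2" "h \<in> L2"
  shows "L2_inner (\<lambda>x. f x + g x) h = L2_inner f h + L2_inner g h"
  using assms by (simp add: L2_inner_def distrib_right L2_integrable_mult L2_cnj)

lemma L2_inner_diff_left:
  assumes "f \<in> L2" "g \<in> L2" "h \<in> L2"
  shows "L2_inner (\<lambda>x. f x - g x) h = L2_inner f h - L2_inner g h"
  using assms by (simp add: L2_inner_def left_diff_distrib L2_integrable_mult L2_cnj)

lemma L2_inner_add_right:
  assumes "f \<in> L2" "g \<in> L2" "h \<in> L2"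
  shows "L2_inner h (\<lambda>x. f x + g x) = L2_inner h f + L2_inner h g"
  using assms by (simp add: L2_inner_def distrib_left L2_integrable_mult L2_cnj)

lemma L2_inner_bound:
  assumes "f \<in> L2" "g \<in> L2"
  shows "cmod (L2_inner f g) \<le> L2_norm f * L2_norm g"
proof -
  have "cmod (L2_inner f g) \<le> (LINT x|lborel. cmod (f x) * cmod (g x))"
    unfolding L2_inner_def using integral_norm_bound[of lborel "\<lambda>x. f x * cnj (g x)"]
    by (simp add: norm_mult)
  then show ?thesis using L2_Cauchy_Schwarz[OF assms] by simp
qed

lemma L2_inner_tendsto_left:
  assumes "\<And>n. s n \<in> L2" "f \<in> L2" "g \<in> L2" "(\<lambda>n. L2_norm (\<lambda>x. s n x - f x)) \<longlonglongrightarrow> 0"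
  shows "(\<lambda>n. L2_inner (s n) g) \<longlonglongrightarrow> L2_inner f g"
proof (rule LIM_zero_cancel, rule Lim_null_comparison)
  show "(\<lambda>n. L2_norm (\<lambda>x. s n x - f x) * L2_norm g) \<longlonglongrightarrow> 0"
    using tendsto_mult_right[OF assms(4), of "L2_norm g"] by simp
  show "\<forall>\<^sub>F n in sequentially. norm (L2_inner (s n) g - L2_inner f g)
      \<le> L2_norm (\<lambda>x. s n x - f x) * L2_norm g"
    using L2_inner_bound[OF L2_diff[OF assms(1,2)] assms(3)] assms(1-3)
    by (simp add: L2_inner_diff_left)
qed

text \<open>The fourth roots of unity c have c cnj(c) = 1, while c and c^2 sum to 0 over them, so
  only the term with \<open>L2_inner f g\<close> survives. It turns the isometry of the Fourier
  transform into preservation of inner products.\<close>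

lemma L2_polarization:
  assumes "f \<in> L2" "g \<in> L2"
  shows "4 * L2_inner f g = (\<Sum>c\<in>{1, -1, \<i>, -\<i>}. c * complex_of_real ((L2_norm (\<lambda>x. f x + c * g x))\<^sup>2))"
proof -
  define N where "N = (\<lambda>c. complex_of_real ((L2_norm (\<lambda>x. f x + c * g x))\<^sup>2))"
  have N: "N c = L2_inner f f + cnj c * L2_inner f g + c * L2_inner g f + c * cnj c * L2_inner g g" for c
    unfolding N_def L2_inner_self[symmetric] using assms
    by (simp add: L2_inner_add_left L2_inner_add_right L2_inner_scale_left L2_inner_scale_right
        L2_scale L2_add algebra_simps)
  have "4 * L2_inner f g = (\<Sum>c\<in>{1, -1, \<i>, -\<i>}. c * N c)"
    by (simp add: N complex_eq_iff)
  then show ?thesis by (simp only: N_def)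
qed

subsection \<open>The Fourier integral\<close>

lemma fourier_integral_integrable:
  assumes "integrable lborel f"
  shows "integrable lborel (\<lambda>x. exp (- \<i> * complex_of_real (\<xi> \<bullet> x)) * f x)"
proof -
  have [measurable]: "f \<in> borel_measurable borel" using borel_measurable_integrable[OF assms] by simp
  show ?thesis
    by (rule Bochner_Integration.integrable_bound[OF assms]) (auto simp: norm_mult)
qed

lemma fourier_integral_measurable:
  assumes "f \<in> borel_measurable borel"
  shows "fourier_integral f \<in> borel_measurable borel"
proof -
  note [measurable] = assms
  show ?thesis unfolding fourier_integral_def[abs_def] by measurable
qed

lemma fourier_integral_add:
  assumes "integrable lborel f" "integrable lborel g"
  shows "fourier_integral (\<lambda>x. f x + g x) \<xi> = fourier_integral f \<xi> + fourier_integral g \<xi>"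
  by (simp only: fourier_integral_def distrib_left
      Bochner_Integration.integral_add[OF assms[THEN fourier_integral_integrable]])

lemma fourier_integral_scale: "fourier_integral (\<lambda>x. c * f x) \<xi> = c * fourier_integral f \<xi>"
  by (simp add: fourier_integral_def mult.left_commute[of _ c])

lemma fourier_integral_bound:
  fixes f :: "'a::euclidean_space \<Rightarrow> complex"
  assumes "integrable lborel f"
  shows "cmod (fourier_integral f \<xi>)
    \<le> (2 * pi) powr (- (real DIM('a) / 2)) * (LINT x|lborel. cmod (f x))"
proof -
  have "cmod (LINT x|lborel. exp (- \<i> * complex_of_real (\<xi> \<bullet> x)) * f x)
      \<le> (LINT x|lborel. cmod (exp (- \<i> * complex_of_real (\<xi> \<bullet> x)) * f x))"
    by (rule integral_norm_bound)
  then show ?thesis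
    by (simp add: fourier_integral_def norm_mult mult_left_mono)
qed

text \<open>Both sides are the same double integral, because the kernel is symmetric in xi and x.
  Fubini applies since the integrand has modulus |f x| |g xi|. Plancherel's theorem and the weak
  description of the transform on L2 both rest on this.\<close>

lemma fourier_integral_multiplication:
  fixes f g :: "'a::euclidean_space \<Rightarrow> complex"
  assumes f: "integrable lborel f" and g: "integrable lborel g"
  shows "(LINT \<xi>|lborel. fourier_integral f \<xi> * g \<xi>) = (LINT x|lborel. f x * fourier_integral g x)"
proof -
  have [measurable]: "f \<in> borel_measurable borel" "g \<in> borel_measurable borel"
    using f g by (auto dest: borel_measurable_integrable)
  let ?k = "\<lambda>\<xi> x. exp (- \<i> * complex_of_real (\<xi> \<bullet> x)) * f x * g \<xi>"
  have "integrable (lborel \<Otimes>\<^sub>M lborel) (\<lambda>(\<xi>, x). ?k \<xi> x)"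
  proof (rule lborel_pair.Fubini_integrable)
    show "integrable lborel (\<lambda>\<xi>. LINT x|lborel. norm (case (\<xi>, x) of (\<xi>, x) \<Rightarrow> ?k \<xi> x))"
      using g by (simp add: norm_mult)
    show "AE \<xi> in lborel. integrable lborel (\<lambda>x. case (\<xi>, x) of (\<xi>, x) \<Rightarrow> ?k \<xi> x)"
      by (rule AE_I2) (use fourier_integral_integrable[OF f] in simp)
  qed measurable
  from lborel_pair.Fubini_integral[OF this]
  have "(LINT x|lborel. LINT \<xi>|lborel. ?k \<xi> x) = (LINT \<xi>|lborel. LINT x|lborel. ?k \<xi> x)" .
  moreover have "fourier_integral f \<xi> * g \<xi>
      = complex_of_real ((2 * pi) powr (- (real DIM('a) / 2))) * (LINT x|lborel. ?k \<xi> x)" for \<xi>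
    by (simp add: fourier_integral_def)
  moreover have "f x * fourier_integral g x
      = complex_of_real ((2 * pi) powr (- (real DIM('a) / 2))) * (LINT \<xi>|lborel. ?k \<xi> x)" for x
    by (simp add: fourier_integral_def inner_commute[of _ x] mult.assoc mult.left_commute[of _ "f x"])
  ultimately show ?thesis
    by (simp only: Bochner_Integration.integral_mult_right_zero)
qed

subsection \<open>The Gaussian\<close>

definition gaussian :: "'a::euclidean_space \<Rightarrow> complex" where
  "gaussian x = complex_of_real (exp (- (norm x)\<^sup>2 / 2))"

lemma gaussian_measurable [measurable]: "gaussian \<in> borel_measurable borel"
  unfolding gaussian_def[abs_def] by measurable

text \<open>Read off from the characteristic function of the standard normal distribution. That
  function uses exp(i t x), so it is evaluated at -t; the factor sqrt (2 pi) removes the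
  normalization of the density.\<close>

lemma has_bochner_integral_gaussian_real:
  fixes t :: real
  shows "has_bochner_integral lborel
    (\<lambda>x. exp (- \<i> * complex_of_real (t * x)) * complex_of_real (exp (- x\<^sup>2 / 2)))
    (complex_of_real (sqrt (2 * pi)) * complex_of_real (exp (- t\<^sup>2 / 2)))"
proof -
  let ?f = "\<lambda>x. exp (\<i> * complex_of_real (- t * x))"
  have f: "?f \<in> borel_measurable lborel" by measurable
  have m: "std_normal_density \<in> borel_measurable lborel" by simp
  have nn: "AE x in lborel. 0 \<le> std_normal_density x" by simp
  interpret N: real_distribution std_normal_distribution by (rule real_dist_normal_dist)
  have "integrable std_normal_distribution ?f"
    by (rule N.integrable_const_bound[where B = 1]) (auto simp: norm_exp_i_times[of "- t * _", simplified])
  then have "has_bochner_integral std_normal_distribution ?f (char std_normal_distribution (- t))"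
    unfolding char_def by (rule has_bochner_integral_integrable)
  then have "has_bochner_integral std_normal_distribution ?f (complex_of_real (exp (- t\<^sup>2 / 2)))"
    by (simp only: char_std_normal_distribution power2_minus)
  then have "has_bochner_integral lborel (\<lambda>x. std_normal_density x *\<^sub>R ?f x) (complex_of_real (exp (- t\<^sup>2 / 2)))"
    unfolding has_bochner_integral_iff
    by (simp only: integrable_density[OF f m nn]
        integral_density[OF f m nn])
  then have "has_bochner_integral lborel
      (\<lambda>x. complex_of_real (sqrt (2 * pi)) * (std_normal_density x *\<^sub>R ?f x))
      (complex_of_real (sqrt (2 * pi)) * complex_of_real (exp (- t\<^sup>2 / 2)))"
    by (intro has_bochner_integral_mult_right)
  moreover have "complex_of_real (sqrt (2 * pi)) * (std_normal_density x *\<^sub>R ?f x)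
      = exp (- \<i> * complex_of_real (t * x)) * complex_of_real (exp (- x\<^sup>2 / 2))" for x
    by (simp add: std_normal_density_def scaleR_conv_of_real flip: of_real_mult)
  ultimately show ?thesis by simp
qed

text \<open>The Gaussian and the character both factor over the coordinates, and
  \<open>lborel_eq\<close> presents Lebesgue measure as the image of a product of one-dimensional
  ones.\<close>

lemma has_bochner_integral_gaussian:
  fixes \<xi> :: "'a::euclidean_space"
  shows "has_bochner_integral lborel (\<lambda>x. exp (- \<i> * complex_of_real (\<xi> \<bullet> x)) * gaussian x)
    (complex_of_real ((2 * pi) powr (real DIM('a) / 2)) * gaussian \<xi>)"
proof -
  let ?F = "\<lambda>x :: 'a. exp (- \<i> * complex_of_real (\<xi> \<bullet> x)) * gaussian x"
  let ?P = "\<Pi>\<^sub>M b\<in>(Basis :: 'a set). (lborel :: real measure)"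
  let ?k = "\<lambda>b x. exp (- \<i> * complex_of_real ((\<xi> \<bullet> b) * x)) * complex_of_real (exp (- x\<^sup>2 / 2))"
  let ?T = "\<lambda>y. \<Sum>b\<in>Basis. y b *\<^sub>R (b :: 'a)"
  interpret product_sigma_finite "\<lambda>_. lborel :: real measure" ..
  have norm: "(norm x)\<^sup>2 = (\<Sum>b\<in>Basis. (x \<bullet> b)\<^sup>2)" for x :: 'a
    by (subst power2_norm_eq_inner, subst euclidean_inner) (simp add: power2_eq_square)
  have gauss: "complex_of_real (exp (- (norm x)\<^sup>2 / 2)) = (\<Prod>b\<in>Basis. complex_of_real (exp (- (x \<bullet> b)\<^sup>2 / 2)))"
    for x :: 'a
    unfolding norm by (simp add: exp_sum sum_negf[symmetric] sum_divide_distrib)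
  have prod: "?F (?T y) = (\<Prod>b\<in>Basis. ?k b (y b))" for y
  proof -
    have "\<xi> \<bullet> ?T y = (\<Sum>b\<in>Basis. (\<xi> \<bullet> b) * y b)"
      by (simp add: inner_sum_right mult.commute)
    then show ?thesis
      unfolding gaussian_def gauss prod.distrib
      by (simp add: exp_sum sum_distrib_left sum_negf[symmetric] inner_sum_left_Basis)
  qed
  have T [measurable]: "?T \<in> ?P \<rightarrow>\<^sub>M borel" by measurable
  have F [measurable]: "?F \<in> borel_measurable borel" by measurable
  note k = has_bochner_integral_gaussian_real[of "\<xi> \<bullet> _"]
  have "integrable ?P (\<lambda>y. \<Prod>b\<in>Basis. ?k b (y b))"
    by (rule product_integrable_prod[OF finite_Basis integrable.intros[OF k]])
  then have int: "integrable lborel ?F"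
    by (subst lborel_eq) (simp only: integrable_distr_eq[OF T F] prod)
  have "integral\<^sup>L lborel ?F = integral\<^sup>L ?P (\<lambda>y. \<Prod>b\<in>Basis. ?k b (y b))"
    by (subst lborel_eq) (simp only: integral_distr[OF T F] prod)
  also have "\<dots> = (\<Prod>b\<in>Basis. integral\<^sup>L lborel (?k b))"
    by (rule product_integral_prod[OF finite_Basis integrable.intros[OF k]])
  also have "\<dots> = (\<Prod>b\<in>(Basis :: 'a set). complex_of_real (sqrt (2 * pi)) * complex_of_real (exp (- (\<xi> \<bullet> b)\<^sup>2 / 2)))"
    by (intro prod.cong refl has_bochner_integral_integral_eq k)
  also have "\<dots> = complex_of_real ((2 * pi) powr (real DIM('a) / 2)) * gaussian \<xi>"
    unfolding prod.distrib gauss[symmetric] gaussian_def[symmetric]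
    by (simp add: powr_half_sqrt[symmetric] powr_powr powr_realpow[symmetric] flip: of_real_power)
  finally show ?thesis using int by (simp add: has_bochner_integral_iff)
qed

lemma gaussian_integrable: "integrable lborel (gaussian :: 'a::euclidean_space \<Rightarrow> complex)"
  using integrable.intros[OF has_bochner_integral_gaussian[of "0::'a"]] by simp

lemma integral_gaussian:
  "integral\<^sup>L lborel (gaussian :: 'a::euclidean_space \<Rightarrow> complex) = complex_of_real ((2 * pi) powr (real DIM('a) / 2))"
  using has_bochner_integral_integral_eq[OF has_bochner_integral_gaussian[of "0::'a"]]
  by (simp add: gaussian_def[abs_def])

lemma fourier_integral_gaussian: "fourier_integral gaussian = (gaussian :: 'a::euclidean_space \<Rightarrow> complex)"
proof
  fix \<xi> :: 'a
  have "(2 * pi) powr (- (real DIM('a) / 2)) * (2 * pi) powr (real DIM('a) / 2) = 1"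
    by (simp add: powr_add[symmetric])
  then have "complex_of_real ((2 * pi) powr (- (real DIM('a) / 2))) * complex_of_real ((2 * pi) powr (real DIM('a) / 2)) = 1"
    by (metis of_real_1 of_real_mult)
  then show "fourier_integral gaussian \<xi> = gaussian \<xi>"
    unfolding fourier_integral_def has_bochner_integral_integral_eq[OF has_bochner_integral_gaussian]
    by (simp add: mult.assoc[symmetric] del: of_real_mult)
qed

lemma lborel_integral_affine:
  fixes f :: "'a::euclidean_space \<Rightarrow> complex"
  assumes "f \<in> borel_measurable borel" "c \<noteq> 0"
  shows "(LINT x|lborel. f x) = complex_of_real (\<bar>c\<bar> ^ DIM('a)) * (LINT x|lborel. f (t + c *\<^sub>R x))"
proof -
  note [measurable] = assms(1)
  show ?thesis
    by (subst lborel_affine[OF assms(2), of t])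
      (simp add: integral_density integral_distr scaleR_conv_of_real)
qed

subsection \<open>Plancherel's theorem for bounded continuous integrable functions\<close>

text \<open>The class is dictated by Gaussian summation: boundedness and continuity give bounded
  pointwise convergence of the Gaussian averages of f, and integrability gives the Fourier integral.
  Nothing is assumed about integrability of the transform.\<close>

definition test_functions :: "('a::euclidean_space \<Rightarrow> complex) set" where
  "test_functions = {f. continuous_on UNIV f \<and> bounded (range f) \<and> integrable lborel f}"

lemma test_function_measurable: "f \<in> test_functions \<Longrightarrow> f \<in> borel_measurable borel"
  by (simp add: test_functions_def borel_measurable_continuous_onI)

lemma test_function_L2:
  assumes "f \<in> test_functions"
  shows "f \<in> L2"
proof (rule L2_I)
  show [measurable]: "f \<in> borel_measurable borel" by (rule test_function_measurable[OF assms])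
  obtain M where M: "\<And>x. cmod (f x) \<le> M"
    using assms by (auto simp: test_functions_def bounded_iff)
  have "AE x in lborel. norm ((cmod (f x))\<^sup>2) \<le> norm (M * cmod (f x))"
    using M by (intro AE_I2) (simp add: power2_eq_square abs_mult mult_right_mono order_trans[OF M abs_ge_self])
  then show "integrable lborel (\<lambda>x. (cmod (f x))\<^sup>2)"
    by (rule Bochner_Integration.integrable_bound[rotated 2])
      (use assms in \<open>auto simp: test_functions_def\<close>)
qed

lemma test_functions_add: "f \<in> test_functions \<Longrightarrow> g \<in> test_functions \<Longrightarrow> (\<lambda>x. f x + g x) \<in> test_functions"
  by (auto simp: test_functions_def intro!: continuous_intros bounded_plus_comp)

lemma test_functions_scale: "f \<in> test_functions \<Longrightarrow> (\<lambda>x. c * f x) \<in> test_functions"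
  using bounded_linear_image[OF _ bounded_linear_mult_right[of c], of "range f"]
  by (auto simp: test_functions_def image_image intro!: continuous_intros)

lemma lborel_integrable_affine:
  fixes f :: "'a::euclidean_space \<Rightarrow> complex"
  assumes f: "integrable lborel f" and c: "c \<noteq> 0"
  shows "integrable lborel (\<lambda>x. f (t + c *\<^sub>R x))"
proof -
  have [measurable]: "f \<in> borel_measurable borel" using borel_measurable_integrable[OF f] by simp
  have "integrable (density (distr lborel borel (\<lambda>x. t + c *\<^sub>R x)) (\<lambda>_. \<bar>c\<bar> ^ DIM('a))) f"
    using f by (simp add: lborel_affine[OF c, of t, symmetric])
  then have "integrable lborel (\<lambda>x. \<bar>c\<bar> ^ DIM('a) *\<^sub>R f (t + c *\<^sub>R x))"
    by (simp add: integrable_density integrable_distr_eq)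
  from integrable_scaleR_right[OF this, of "inverse (\<bar>c\<bar> ^ DIM('a))"] show ?thesis
    using c by simp
qed

text \<open>Smoothing by the heat kernel corresponds to damping the transform by a Gaussian.\<close>

lemma fourier_integral_gaussian_damping:
  fixes f :: "'a::euclidean_space \<Rightarrow> complex"
  assumes f: "integrable lborel f" and d: "d \<noteq> 0"
  shows "(LINT \<xi>|lborel. fourier_integral f \<xi> * (exp (\<i> * complex_of_real (\<xi> \<bullet> y)) * gaussian (d *\<^sub>R \<xi>)))
    = (LINT z|lborel. f (y + d *\<^sub>R z) * gaussian z)"
proof -
  have [measurable]: "f \<in> borel_measurable borel" using borel_measurable_integrable[OF f] by simp
  let ?c = "complex_of_real ((2 * pi) powr (- (real DIM('a) / 2)))"
  let ?g = "\<lambda>\<xi>. exp (\<i> * complex_of_real (\<xi> \<bullet> y)) * gaussian (d *\<^sub>R \<xi>)"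
  have "integrable lborel (\<lambda>\<xi>. gaussian (d *\<^sub>R \<xi> :: 'a))"
    using lborel_integrable_affine[OF gaussian_integrable d, of 0] by simp
  then have g: "integrable lborel ?g"
    by (rule Bochner_Integration.integrable_bound) (auto simp: norm_mult)
  \<comment> \<open>The modulation in \<open>?g\<close> cancels the shift by y, and substituting d
    xi leaves the transform of the Gaussian, which is the Gaussian. The summand 0 brings the
    integrand into the form of \<open>lborel_integral_affine\<close>.\<close>
  have Fg: "complex_of_real (\<bar>d\<bar> ^ DIM('a)) * fourier_integral ?g (y + d *\<^sub>R z) = gaussian z" for z
  proof -
    have "exp (- \<i> * complex_of_real ((y + d *\<^sub>R z) \<bullet> \<xi>)) * ?g \<xi>
        = exp (- \<i> * complex_of_real (z \<bullet> (0 + d *\<^sub>R \<xi>))) * gaussian (0 + d *\<^sub>R \<xi>)" for \<xi>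
      unfolding mult.assoc[symmetric] exp_add[symmetric]
      by (simp add: inner_add_left inner_commute[of y] distrib_left)
    then have "fourier_integral ?g (y + d *\<^sub>R z)
        = ?c * (LINT \<xi>|lborel. exp (- \<i> * complex_of_real (z \<bullet> (0 + d *\<^sub>R \<xi>))) * gaussian (0 + d *\<^sub>R \<xi>))"
      by (simp only: fourier_integral_def)
    moreover have "(LINT \<xi>|lborel. exp (- \<i> * complex_of_real (z \<bullet> \<xi>)) * gaussian \<xi>)
        = complex_of_real (\<bar>d\<bar> ^ DIM('a)) *
          (LINT \<xi>|lborel. exp (- \<i> * complex_of_real (z \<bullet> (0 + d *\<^sub>R \<xi>))) * gaussian (0 + d *\<^sub>R \<xi>))"
      by (rule lborel_integral_affine[OF _ d]) measurable
    ultimately have "complex_of_real (\<bar>d\<bar> ^ DIM('a)) * fourier_integral ?g (y + d *\<^sub>R z) = fourier_integral gaussian z"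
      by (simp only: fourier_integral_def mult.left_commute)
    then show ?thesis by (simp only: fourier_integral_gaussian)
  qed
  have [measurable]: "fourier_integral ?g \<in> borel_measurable borel"
    using borel_measurable_integrable[OF g] by (intro fourier_integral_measurable) simp
  have "(LINT \<xi>|lborel. fourier_integral f \<xi> * ?g \<xi>) = (LINT x|lborel. f x * fourier_integral ?g x)"
    by (rule fourier_integral_multiplication[OF f g])
  also have "\<dots> = complex_of_real (\<bar>d\<bar> ^ DIM('a)) *
      (LINT z|lborel. f (y + d *\<^sub>R z) * fourier_integral ?g (y + d *\<^sub>R z))"
    by (rule lborel_integral_affine[OF _ d]) measurable
  also have "\<dots> = (LINT z|lborel. complex_of_real (\<bar>d\<bar> ^ DIM('a)) *
      (f (y + d *\<^sub>R z) * fourier_integral ?g (y + d *\<^sub>R z)))"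
    by (simp only: Bochner_Integration.integral_mult_right_zero)
  also have "\<dots> = (LINT z|lborel. f (y + d *\<^sub>R z) * gaussian z)"
    by (simp only: mult.left_commute[of "complex_of_real (\<bar>d\<bar> ^ DIM('a))"] Fg)
  finally show ?thesis .
qed

text \<open>The multiplication formula for f and for h, the conjugate of the transform of f times a
  Gaussian: the transform of h is the conjugate of the damped inversion integral, which the previous
  lemma evaluates as a Gaussian average of f. Boundedness of the transform makes h
  integrable.\<close>

lemma integral_fourier_square_gaussian:
  fixes f :: "'a::euclidean_space \<Rightarrow> complex"
  assumes f: "integrable lborel f" and d: "d \<noteq> 0"
  shows "integrable lborel (\<lambda>\<xi>. (cmod (fourier_integral f \<xi>))\<^sup>2 * exp (- (norm (d *\<^sub>R \<xi>))\<^sup>2 / 2))"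
    and "complex_of_real (LINT \<xi>|lborel. (cmod (fourier_integral f \<xi>))\<^sup>2 * exp (- (norm (d *\<^sub>R \<xi>))\<^sup>2 / 2))
      = complex_of_real ((2 * pi) powr (- (real DIM('a) / 2))) *
        (LINT x|lborel. f x * cnj (LINT z|lborel. f (x + d *\<^sub>R z) * gaussian z))"
proof -
  have [measurable]: "f \<in> borel_measurable borel" using borel_measurable_integrable[OF f] by simp
  have [measurable]: "fourier_integral f \<in> borel_measurable borel"
    by (rule fourier_integral_measurable) measurable
  let ?c = "complex_of_real ((2 * pi) powr (- (real DIM('a) / 2)))"
  let ?h = "\<lambda>\<xi>. cnj (fourier_integral f \<xi>) * gaussian (d *\<^sub>R \<xi>)"
  obtain M where M: "\<And>\<xi>. cmod (fourier_integral f \<xi>) \<le> M"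
    using fourier_integral_bound[OF f] by blast
  have g: "integrable lborel (\<lambda>\<xi>. gaussian (d *\<^sub>R \<xi> :: 'a))"
    using lborel_integrable_affine[OF gaussian_integrable d, of 0] by simp
  have M0: "0 \<le> M" using norm_ge_zero M by (rule order_trans)
  have "AE \<xi> in lborel. norm (?h \<xi>) \<le> norm (complex_of_real M * gaussian (d *\<^sub>R \<xi>))"
    using M M0 by (intro AE_I2) (simp add: norm_mult mult_right_mono)
  then have h: "integrable lborel ?h"
    by (rule Bochner_Integration.integrable_bound[rotated 2])
      (use integrable_mult_right[OF g] in \<open>simp_all\<close>)
  have sq: "fourier_integral f \<xi> * ?h \<xi>
      = complex_of_real ((cmod (fourier_integral f \<xi>))\<^sup>2 * exp (- (norm (d *\<^sub>R \<xi>))\<^sup>2 / 2))" for \<xi>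
    unfolding mult.assoc[symmetric] complex_norm_square[symmetric] gaussian_def
    by (simp only: of_real_mult of_real_power)
  have "AE \<xi> in lborel. norm (fourier_integral f \<xi> * ?h \<xi>) \<le> norm (complex_of_real M * ?h \<xi>)"
    unfolding norm_mult norm_of_real abs_of_nonneg[OF M0]
    by (intro AE_I2 mult_right_mono M mult_nonneg_nonneg norm_ge_zero)
  then have "integrable lborel (\<lambda>\<xi>. fourier_integral f \<xi> * ?h \<xi>)"
    by (rule Bochner_Integration.integrable_bound[rotated 2])
      (use integrable_mult_right[OF h] in \<open>simp_all\<close>)
  then show "integrable lborel (\<lambda>\<xi>. (cmod (fourier_integral f \<xi>))\<^sup>2 * exp (- (norm (d *\<^sub>R \<xi>))\<^sup>2 / 2))"
    unfolding sq complex_of_real_integrable_eq .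
  have Fh: "fourier_integral ?h x = ?c * cnj (LINT z|lborel. f (x + d *\<^sub>R z) * gaussian z)" for x
  proof -
    have "exp (- \<i> * complex_of_real (x \<bullet> \<xi>)) * ?h \<xi>
      = cnj (fourier_integral f \<xi> * (exp (\<i> * complex_of_real (\<xi> \<bullet> x)) * gaussian (d *\<^sub>R \<xi>)))" for \<xi>
      by (simp add: exp_cnj gaussian_def inner_commute[of x] mult_ac)
    then show ?thesis
      unfolding fourier_integral_gaussian_damping[OF f d, symmetric] fourier_integral_def[of ?h]
        Bochner_Integration.integral_cnj[symmetric]
      by (simp only:)
  qed
  have "complex_of_real (LINT \<xi>|lborel. (cmod (fourier_integral f \<xi>))\<^sup>2 * exp (- (norm (d *\<^sub>R \<xi>))\<^sup>2 / 2))
      = (LINT \<xi>|lborel. fourier_integral f \<xi> * ?h \<xi>)"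
    by (simp only: sq integral_complex_of_real)
  also have "\<dots> = (LINT x|lborel. f x * fourier_integral ?h x)"
    by (rule fourier_integral_multiplication[OF f h])
  also have "\<dots> = ?c * (LINT x|lborel. f x * cnj (LINT z|lborel. f (x + d *\<^sub>R z) * gaussian z))"
    unfolding Fh mult.left_commute[of "f _" ?c] Bochner_Integration.integral_mult_right_zero ..
  finally show "complex_of_real (LINT \<xi>|lborel. (cmod (fourier_integral f \<xi>))\<^sup>2 * exp (- (norm (d *\<^sub>R \<xi>))\<^sup>2 / 2)) = \<dots>" .
qed

text \<open>The damping tends to 0 in the previous identity. The averages on the right converge to a
  multiple of f, dominated because f is bounded. Square-integrability of the transform is not known
  beforehand, so the left side is treated by monotone convergence of
  \<open>nn_integral\<close>.\<close>

lemma plancherel_test_function: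
  fixes f :: "'a::euclidean_space \<Rightarrow> complex"
  assumes "f \<in> test_functions"
  shows "fourier_integral f \<in> L2" "L2_norm (fourier_integral f) = L2_norm f"
proof -
  have f: "integrable lborel f" and cont: "\<And>x. isCont f x"
    using assms by (auto simp: test_functions_def continuous_on_eq_continuous_at)
  have [measurable]: "f \<in> borel_measurable borel" by (rule test_function_measurable[OF assms])
  have [measurable]: "fourier_integral f \<in> borel_measurable borel"
    by (rule fourier_integral_measurable) measurable
  obtain M where M: "\<And>x. cmod (f x) \<le> M"
    using assms by (auto simp: test_functions_def bounded_iff)
  \<comment> \<open>Nonzero, as the rescaling requires, and decreasing, so that the damping factors
    increase to 1.\<close>
  define \<delta> where "\<delta> n = 1 / real (Suc n)" for n
  have \<delta>: "\<delta> n \<noteq> 0" for n by (simp add: \<delta>_def)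
  have \<delta>0: "\<delta> \<longlonglongrightarrow> 0"
    unfolding \<delta>_def[abs_def] using LIMSEQ_inverse_real_of_nat by (simp add: inverse_eq_divide)
  let ?c = "(2 * pi) powr (- (real DIM('a) / 2))"
  let ?C = "(2 * pi) powr (real DIM('a) / 2)"
  define K where "K n x = (LINT z|lborel. f (x + \<delta> n *\<^sub>R z) * gaussian z)" for n x
  have [measurable]: "K n \<in> borel_measurable borel" for n
    unfolding K_def[abs_def] by measurable
  have bound: "cmod (f (x + \<delta> n *\<^sub>R z) * gaussian z) \<le> M * cmod (gaussian z)" for x z n
    unfolding norm_mult by (intro mult_right_mono M norm_ge_zero)
  have int: "integrable lborel (\<lambda>z :: 'a. M * cmod (gaussian z))"
    by (intro integrable_mult_right integrable_norm gaussian_integrable)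
  have K_lim: "(\<lambda>n. K n x) \<longlonglongrightarrow> f x * complex_of_real ?C" for x
  proof -
    have "(\<lambda>n. K n x) \<longlonglongrightarrow> (LINT z|(lborel :: 'a measure). f x * gaussian z)"
      unfolding K_def
    proof (rule integral_dominated_convergence)
      show "AE z in lborel. (\<lambda>n. f (x + \<delta> n *\<^sub>R z) * gaussian z) \<longlonglongrightarrow> f x * gaussian z"
      proof (rule AE_I2)
        fix z
        have "(\<lambda>n. x + \<delta> n *\<^sub>R z) \<longlonglongrightarrow> x + 0 *\<^sub>R z"
          by (intro tendsto_intros \<delta>0)
        then have "(\<lambda>n. f (x + \<delta> n *\<^sub>R z)) \<longlonglongrightarrow> f x"
          using isCont_tendsto_compose[OF cont] by simp
        then show "(\<lambda>n. f (x + \<delta> n *\<^sub>R z) * gaussian z) \<longlonglongrightarrow> f x * gaussian z"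
          by (intro tendsto_intros)
      qed
      show "AE z in lborel. norm (f (x + \<delta> n *\<^sub>R z) * gaussian z) \<le> M * cmod (gaussian z)" for n
        by (intro AE_I2 bound)
      show "integrable lborel (\<lambda>z :: 'a. M * cmod (gaussian z))" by (rule int)
    qed simp_all
    then show ?thesis by (simp add: integral_gaussian)
  qed
  have K_bound: "cmod (K n x) \<le> (LINT z|(lborel :: 'a measure). M * cmod (gaussian z))" for n x
  proof -
    have "cmod (K n x) \<le> (LINT z|lborel. cmod (f (x + \<delta> n *\<^sub>R z) * gaussian z))"
      unfolding K_def by (rule integral_norm_bound)
    also have "\<dots> \<le> (LINT z|(lborel :: 'a measure). M * cmod (gaussian z))"
      by (rule integral_mono'[OF int bound]) (rule order_trans[OF norm_ge_zero bound])
    finally show ?thesis .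
  qed
  define J where "J n = (LINT \<xi>|lborel. (cmod (fourier_integral f \<xi>))\<^sup>2 * exp (- (norm (\<delta> n *\<^sub>R \<xi>))\<^sup>2 / 2))" for n
  have "(\<lambda>n. LINT x|lborel. f x * cnj (K n x)) \<longlonglongrightarrow> (LINT x|lborel. f x * cnj (f x * complex_of_real ?C))"
  proof (rule integral_dominated_convergence)
    show "integrable lborel (\<lambda>x. cmod (f x) * (LINT z|(lborel :: 'a measure). M * cmod (gaussian z)))"
      by (intro integrable_mult_left integrable_norm f)
    show "AE x in lborel. (\<lambda>n. f x * cnj (K n x)) \<longlonglongrightarrow> f x * cnj (f x * complex_of_real ?C)"
      by (intro AE_I2 tendsto_intros K_lim)
    show "AE x in lborel. norm (f x * cnj (K n x))
        \<le> cmod (f x) * (LINT z|(lborel :: 'a measure). M * cmod (gaussian z))" for n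
      unfolding norm_mult complex_mod_cnj by (intro AE_I2 mult_left_mono K_bound norm_ge_zero)
  qed measurable
  then have "(\<lambda>n. complex_of_real ?c * (LINT x|lborel. f x * cnj (K n x)))
      \<longlonglongrightarrow> complex_of_real ?c * (LINT x|lborel. f x * cnj (f x * complex_of_real ?C))"
    by (intro tendsto_intros)
  \<comment> \<open>The normalization of the transform cancels the total mass of the
    Gaussian.\<close>
  moreover have "complex_of_real ?c * (LINT x|lborel. f x * cnj (f x * complex_of_real ?C)) = complex_of_real ((L2_norm f)\<^sup>2)"
  proof -
    have "complex_of_real ?c * complex_of_real ?C = 1"
      by (simp add: powr_add[symmetric] flip: of_real_mult)
    moreover have "(LINT x|lborel. f x * cnj (f x * complex_of_real ?C)) = complex_of_real ?C * L2_inner f f"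
      unfolding L2_inner_def by (simp add: mult.assoc[symmetric] mult.commute)
    ultimately show ?thesis by (simp add: L2_inner_self mult.assoc[symmetric])
  qed
  ultimately have "(\<lambda>n. complex_of_real (J n)) \<longlonglongrightarrow> complex_of_real ((L2_norm f)\<^sup>2)"
    unfolding J_def integral_fourier_square_gaussian(2)[OF f \<delta>] K_def by (simp only:)
  then have J: "J \<longlonglongrightarrow> (L2_norm f)\<^sup>2"
    using tendsto_of_real_iff by blast
  let ?S = "\<lambda>n \<xi>. ennreal ((cmod (fourier_integral f \<xi>))\<^sup>2 * exp (- (norm (\<delta> n *\<^sub>R \<xi>))\<^sup>2 / 2))"
  have nnJ: "(\<integral>\<^sup>+\<xi>. ?S n \<xi> \<partial>lborel) = ennreal (J n)" for n
    unfolding J_def by (rule nn_integral_eq_integral[OF integral_fourier_square_gaussian(1)[OF f \<delta>]]) simp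
  have inc: "incseq (\<lambda>n. ?S n \<xi>)" for \<xi>
    by (intro incseq_SucI ennreal_leI mult_left_mono)
      (auto simp: \<delta>_def norm_power power_mult_distrib divide_right_mono mult_right_mono power_mono frac_le)
  have "(SUP n. ?S n \<xi>) = ennreal ((cmod (fourier_integral f \<xi>))\<^sup>2)" for \<xi>
  proof (rule LIMSEQ_unique[OF LIMSEQ_SUP[OF inc]])
    have "(\<lambda>n. ?S n \<xi>) \<longlonglongrightarrow> ennreal ((cmod (fourier_integral f \<xi>))\<^sup>2 * exp (- (norm (0 *\<^sub>R \<xi>))\<^sup>2 / 2))"
      by (intro tendsto_ennrealI tendsto_intros \<delta>0) simp
    then show "(\<lambda>n. ?S n \<xi>) \<longlonglongrightarrow> ennreal ((cmod (fourier_integral f \<xi>))\<^sup>2)" by simp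
  qed
  then have "(\<integral>\<^sup>+\<xi>. ennreal ((cmod (fourier_integral f \<xi>))\<^sup>2) \<partial>lborel) = (\<integral>\<^sup>+\<xi>. (SUP n. ?S n \<xi>) \<partial>lborel)"
    by simp
  also have "\<dots> = (SUP n. \<integral>\<^sup>+\<xi>. ?S n \<xi> \<partial>lborel)"
    by (rule nn_integral_monotone_convergence_SUP) (use inc in \<open>auto simp: incseq_def le_fun_def\<close>)
  also have "\<dots> = (SUP n. ennreal (J n))"
    unfolding nnJ ..
  also have "\<dots> = ennreal ((L2_norm f)\<^sup>2)"
  proof (rule LIMSEQ_unique[OF LIMSEQ_SUP])
    show "incseq (\<lambda>n. ennreal (J n))"
    proof (rule incseq_SucI)
      fix n
      have "(\<integral>\<^sup>+\<xi>. ?S n \<xi> \<partial>lborel) \<le> (\<integral>\<^sup>+\<xi>. ?S (Suc n) \<xi> \<partial>lborel)"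
        by (intro nn_integral_mono incseq_SucD inc)
      then show "ennreal (J n) \<le> ennreal (J (Suc n))"
        unfolding nnJ .
    qed
    show "(\<lambda>n. ennreal (J n)) \<longlonglongrightarrow> ennreal ((L2_norm f)\<^sup>2)"
      by (intro tendsto_ennrealI J)
  qed
  finally have *: "(\<integral>\<^sup>+\<xi>. ennreal ((cmod (fourier_integral f \<xi>))\<^sup>2) \<partial>lborel) = ennreal ((L2_norm f)\<^sup>2)" .
  then show F: "fourier_integral f \<in> L2"
    by (intro L2_nn_integralI) auto
  show "L2_norm (fourier_integral f) = L2_norm f"
    using * unfolding nn_integral_L2_norm[OF F] by (simp add: power2_eq_iff_nonneg)
qed

subsection \<open>Density of the test functions\<close>

lemma cmod_indicator_square: "(cmod (indicator A x))\<^sup>2 = indicator A x"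
  by (simp add: indicator_def)

lemma indicator_L2:
  fixes A :: "'a::euclidean_space set"
  assumes "A \<in> sets borel" "emeasure lborel A < \<infinity>"
  shows "(\<lambda>x. indicator A x :: complex) \<in> L2"
proof -
  have "integrable lborel (indicator A :: 'a \<Rightarrow> real)"
    using assms by (intro integrable_real_indicator) auto
  then show ?thesis
    using assms(1) by (simp add: L2_def cmod_indicator_square)
qed

text \<open>Density is obtained by showing that this closure is stable under linear combinations and
  L2 limits and contains, in turn, the indicators of open and of Borel sets of finite measure, and
  with them the simple functions in L2.\<close>

definition test_closure :: "('a::euclidean_space \<Rightarrow> complex) set" where
  "test_closure = {f \<in> L2. \<forall>e>0. \<exists>\<phi>\<in>test_functions. L2_norm (\<lambda>x. \<phi> x - f x) < e}"

lemma test_closureD: "f \<in> test_closure \<Longrightarrow> f \<in> L2"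
  by (simp add: test_closure_def)

lemma test_closure_limit:
  assumes s: "\<And>n. s n \<in> test_closure" and f: "f \<in> L2"
    and lim: "(\<lambda>n. L2_norm (\<lambda>x. s n x - f x)) \<longlonglongrightarrow> 0"
  shows "f \<in> test_closure"
proof -
  have "\<exists>\<phi>\<in>test_functions. L2_norm (\<lambda>x. \<phi> x - f x) < e" if "e > 0" for e
  proof -
    have "\<forall>\<^sub>F n in sequentially. L2_norm (\<lambda>x. s n x - f x) < e / 2"
      using order_tendstoD(2)[OF lim, of "e / 2"] that by simp
    then obtain n where n: "L2_norm (\<lambda>x. s n x - f x) < e / 2"
      by (auto simp: eventually_sequentially)
    obtain \<phi> where \<phi>: "\<phi> \<in> test_functions" "L2_norm (\<lambda>x. \<phi> x - s n x) < e / 2"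
      using s[of n] half_gt_zero[OF \<open>e > 0\<close>] unfolding test_closure_def by blast
    have "L2_norm (\<lambda>x. \<phi> x - f x) < e"
      using L2_norm_triangle_diff[OF test_function_L2[OF \<phi>(1)] test_closureD[OF s[of n]] f] n \<phi>(2)
      by simp
    then show ?thesis using \<phi>(1) by blast
  qed
  then show ?thesis using f by (simp add: test_closure_def)
qed

lemma test_closure_test: "\<phi> \<in> test_functions \<Longrightarrow> \<phi> \<in> test_closure"
  by (auto simp: test_closure_def test_function_L2 intro!: bexI[of _ \<phi>])

text \<open>The geometric rate makes consecutive differences summable in norm, which the
  construction of the Fourier transform uses.\<close>

lemma test_closure_approx:
  assumes "f \<in> test_closure"
  obtains \<phi> where "\<And>n. \<phi> n \<in> test_functions" "\<And>n. L2_norm (\<lambda>x. \<phi> n x - f x) < (1 / 2) ^ n"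
proof -
  have "\<forall>n. \<exists>\<phi>. \<phi> \<in> test_functions \<and> L2_norm (\<lambda>x. \<phi> x - f x) < (1 / 2) ^ n"
    using assms by (auto simp: test_closure_def Bex_def)
  then show ?thesis using that by metis
qed

lemma half_power_tendsto_0: "(\<And>n :: nat. r n < (1 / 2) ^ n) \<Longrightarrow> (\<And>n. 0 \<le> r n) \<Longrightarrow> r \<longlonglongrightarrow> (0 :: real)"
  by (rule tendsto_sandwich[of "\<lambda>_. 0" _ _ "\<lambda>n. (1 / 2) ^ n"])
    (auto intro!: always_eventually less_imp_le LIMSEQ_realpow_zero)

lemma test_closure_scale:
  assumes "f \<in> test_closure"
  shows "(\<lambda>x. c * f x) \<in> test_closure"
proof -
  obtain \<phi> where \<phi>: "\<And>n. \<phi> n \<in> test_functions" "\<And>n. L2_norm (\<lambda>x. \<phi> n x - f x) < (1 / 2) ^ n"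
    using test_closure_approx[OF assms] by blast
  have "(\<lambda>n. cmod c * L2_norm (\<lambda>x. \<phi> n x - f x)) \<longlonglongrightarrow> cmod c * 0"
    by (intro tendsto_intros half_power_tendsto_0 \<phi>(2)) simp
  then have "(\<lambda>n. L2_norm (\<lambda>x. c * \<phi> n x - c * f x)) \<longlonglongrightarrow> 0"
    unfolding L2_norm_scale[symmetric] right_diff_distrib by simp
  then show ?thesis
    by (rule test_closure_limit[OF test_closure_test[OF test_functions_scale[OF \<phi>(1)]]
          L2_scale[OF test_closureD[OF assms]]])
qed

lemma test_closure_add:
  assumes "f \<in> test_closure" "g \<in> test_closure"
  shows "(\<lambda>x. f x + g x) \<in> test_closure"
proof -
  obtain \<phi> where \<phi>: "\<And>n. \<phi> n \<in> test_functions" "\<And>n. L2_norm (\<lambda>x. \<phi> n x - f x) < (1 / 2) ^ n"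
    using test_closure_approx[OF assms(1)] by blast
  obtain \<psi> where \<psi>: "\<And>n. \<psi> n \<in> test_functions" "\<And>n. L2_norm (\<lambda>x. \<psi> n x - g x) < (1 / 2) ^ n"
    using test_closure_approx[OF assms(2)] by blast
  have "(\<lambda>n. L2_norm (\<lambda>x. (\<phi> n x + \<psi> n x) - (f x + g x))) \<longlonglongrightarrow> 0"
  proof (rule tendsto_sandwich[of "\<lambda>_. 0"])
    show "(\<lambda>n. L2_norm (\<lambda>x. \<phi> n x - f x) + L2_norm (\<lambda>x. \<psi> n x - g x)) \<longlonglongrightarrow> 0"
      by (intro tendsto_add_zero half_power_tendsto_0 \<phi>(2) \<psi>(2)) simp_all
    show "\<forall>\<^sub>F n in sequentially. L2_norm (\<lambda>x. (\<phi> n x + \<psi> n x) - (f x + g x))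
        \<le> L2_norm (\<lambda>x. \<phi> n x - f x) + L2_norm (\<lambda>x. \<psi> n x - g x)"
    proof (rule always_eventually, rule allI)
      fix n
      have "L2_norm (\<lambda>x. (\<phi> n x - f x) + (\<psi> n x - g x))
          \<le> L2_norm (\<lambda>x. \<phi> n x - f x) + L2_norm (\<lambda>x. \<psi> n x - g x)"
        by (intro L2_norm_triangle L2_diff test_function_L2 test_closureD \<phi>(1) \<psi>(1) assms)
      then show "L2_norm (\<lambda>x. (\<phi> n x + \<psi> n x) - (f x + g x))
        \<le> L2_norm (\<lambda>x. \<phi> n x - f x) + L2_norm (\<lambda>x. \<psi> n x - g x)"
        by (simp only: add_diff_add)
    qed
  qed simp_all
  then show ?thesis
    by (rule test_closure_limit[OF test_closure_test[OF test_functions_add[OF \<phi>(1) \<psi>(1)]]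
          L2_add[OF assms[THEN test_closureD]]])
qed

lemma test_closure_sum:
  "finite I \<Longrightarrow> (\<And>i. i \<in> I \<Longrightarrow> h i \<in> test_closure) \<Longrightarrow> (\<lambda>x. \<Sum>i\<in>I. h i x) \<in> test_closure"
proof (induction I rule: finite_induct)
  case empty
  have "(\<lambda>x :: 'b. 0 :: complex) \<in> test_functions" by (simp add: test_functions_def)
  then show ?case by (simp add: test_closure_test)
next
  case (insert i I)
  then show ?case by (simp add: test_closure_add)
qed

lemma test_closure_open:
  fixes U :: "'a::euclidean_space set"
  assumes U: "open U" and fin: "emeasure lborel U < \<infinity>"
  shows "(\<lambda>x. indicator U x) \<in> test_closure"
proof -
  \<comment> \<open>\<open>infdist\<close> to the empty set is 0 by convention, which would make
    every ramp below vanish; finite measure excludes U = UNIV.\<close>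
  have ne: "- U \<noteq> {}"
  proof
    assume "- U = {}"
    then have "U = UNIV" by blast
    then show False using fin by simp
  qed
  \<comment> \<open>Continuous ramps that vanish off U. At a point of U the distance to the
    complement is positive, so the ramps are eventually equal to 1 there.\<close>
  define s where "s n x = complex_of_real (min 1 (real n * infdist x (- U)))" for n :: nat and x :: 'a
  have cont: "continuous_on UNIV (s n)" for n
    unfolding s_def[abs_def] by (intro continuous_intros)
  then have [measurable]: "s n \<in> borel_measurable borel" for n
    by (rule borel_measurable_continuous_onI)
  have cs: "cmod (s n x) = min 1 (real n * infdist x (- U))" for n x
    unfolding s_def norm_of_real by (simp add: infdist_nonneg)
  have bound: "cmod (s n x) \<le> 1 * cmod (indicator U x)" for n x
    unfolding cs by (cases "x \<in> U") auto
  have bound': "cmod (s n x) \<le> norm (indicator U x :: real)" for n x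
    using bound[of n x] by (cases "x \<in> U") simp_all
  have ind: "(\<lambda>x. indicator U x :: complex) \<in> L2"
    using U fin by (intro indicator_L2) auto
  have "integrable lborel (indicator U :: 'a \<Rightarrow> real)"
    using U fin by (intro integrable_real_indicator) auto
  then have "integrable lborel (s n)" for n
    by (rule Bochner_Integration.integrable_bound) (use bound' in auto)
  moreover have "bounded (range (s n))" for n
    unfolding bounded_iff cs by (rule exI[of _ 1]) (simp add: cs)
  ultimately have s: "s n \<in> test_functions" for n
    using cont by (simp add: test_functions_def)
  have lim: "(\<lambda>n. s n x) \<longlonglongrightarrow> indicator U x" for x
  proof (cases "x \<in> U")
    case True
    then have "0 < infdist x (- U)"
      using infdist_pos_not_in_closed[of "- U" x] ne U by (auto simp: closed_def)
    then obtain N where N: "1 < real N * infdist x (- U)"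
      using reals_Archimedean3 by blast
    have "s n x = 1" if "N \<le> n" for n
    proof -
      have "real N * infdist x (- U) \<le> real n * infdist x (- U)"
        using that by (intro mult_right_mono) (auto simp: infdist_nonneg)
      then show ?thesis using N by (simp add: s_def)
    qed
    then have "\<forall>\<^sub>F n in sequentially. s n x = 1"
      by (auto simp: eventually_sequentially)
    then show ?thesis using True by (simp add: tendsto_eventually)
  next
    case False
    then show ?thesis by (simp add: s_def)
  qed
  have "(\<lambda>n. L2_norm (\<lambda>x. s n x - indicator U x)) \<longlonglongrightarrow> 0"
    by (rule L2_dominated_convergence(3)[OF ind, where C = 1]) (use lim bound U in auto)
  then show ?thesis
    by (rule test_closure_limit[OF test_closure_test[OF s] ind])
qed

lemma test_closure_indicator:
  fixes A :: "'a::euclidean_space set"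
  assumes A: "A \<in> sets borel" and fin: "emeasure lborel A < \<infinity>"
  shows "(\<lambda>x. indicator A x) \<in> test_closure"
proof -
  \<comment> \<open>The L2 norm of an indicator is the square root of the measure, so 4^-n yields
    the rate 2^-n.\<close>
  have "\<exists>U. open U \<and> A \<subseteq> U \<and> emeasure lborel (U - A) < ennreal ((1 / 4) ^ n)" for n :: nat
    using outer_regular_lborel[OF A, of "(1 / 4) ^ n"] by (metis zero_less_divide_1_iff zero_less_numeral zero_less_power)
  then obtain U where U: "\<And>n. open (U n)" "\<And>n. A \<subseteq> U n"
    "\<And>n. emeasure lborel (U n - A) < ennreal ((1 / 4) ^ n)" by metis
  have UA: "U n - A \<in> sets borel" for n using U(1) A by auto
  have finU: "emeasure lborel (U n) < \<infinity>" for n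
  proof -
    have "emeasure lborel (U n) = emeasure lborel A + emeasure lborel (U n - A)"
      using U A by (subst plus_emeasure) (auto intro!: arg_cong[of _ _ "emeasure lborel"])
    then show ?thesis using fin U(3)[of n] by (auto intro: order_less_trans)
  qed
  have "L2_norm (\<lambda>x. indicator (U n) x - indicator A x) < (1 / 2) ^ n" for n
  proof -
    have eq: "(\<lambda>x. indicator (U n) x - indicator A x :: complex) = (\<lambda>x. indicator (U n - A) x)"
      using U(2)[of n] by (auto simp: fun_eq_iff indicator_def)
    have "emeasure lborel (U n - A) < \<infinity>"
      using U(3)[of n] by (auto intro: order_less_trans)
    then have "L2_norm (\<lambda>x. indicator (U n) x - indicator A x) = sqrt (measure lborel (U n - A))"
      unfolding eq L2_norm_def using UA[of n]
      by (simp add: cmod_indicator_square)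
    also have "\<dots> < sqrt ((1 / 4) ^ n)"
      using U(3)[of n] \<open>emeasure lborel (U n - A) < \<infinity>\<close>
      by (simp add: emeasure_eq_ennreal_measure ennreal_less_iff)
    also have "\<dots> = (1 / 2) ^ n"
      by (simp add: real_sqrt_power real_sqrt_divide)
    finally show ?thesis .
  qed
  then have "(\<lambda>n. L2_norm (\<lambda>x. indicator (U n) x - indicator A x)) \<longlonglongrightarrow> 0"
    by (rule half_power_tendsto_0) simp
  then show ?thesis
    by (rule test_closure_limit[OF test_closure_open[OF U(1) finU] indicator_L2[OF A fin]])
qed

lemma test_closure_eq_L2: "(test_closure :: ('a::euclidean_space \<Rightarrow> complex) set) = L2"
proof (rule antisym)
  show "(L2 :: ('a \<Rightarrow> complex) set) \<subseteq> test_closure"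
  proof
    fix f :: "'a \<Rightarrow> complex" assume f: "f \<in> L2"
    have [measurable]: "f \<in> borel_measurable borel" by (rule L2_measurable[OF f])
    obtain s where s: "\<And>i. simple_function borel (s i)" "\<And>x. (\<lambda>i. s i x) \<longlonglongrightarrow> f x"
      "\<And>i x. dist (s i x) 0 \<le> 2 * dist (f x) 0"
      using borel_measurable_implies_sequence_metric[of f borel 0] by auto
    have sm: "s i \<in> borel_measurable borel" for i
      using s(1) by (rule borel_measurable_simple_function)
    have ae: "AE x in lborel. (\<lambda>n. s n x) \<longlonglongrightarrow> f x"
      "AE x in lborel. \<forall>n. cmod (s n x) \<le> 2 * cmod (f x)"
      using s(2,3) by auto
    have sL: "s i \<in> L2" for i
      by (rule L2_dominated_convergence(2)[OF f sm _ ae]) measurable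
    have "s i \<in> test_closure" for i
    proof -
      have fin: "finite (range (s i))"
        using s(1)[of i] by (simp add: simple_function_def)
      \<comment> \<open>The value 0 is left out because its level set may have infinite
        measure.\<close>
      have eq: "s i x = (\<Sum>c\<in>range (s i) - {0}. c * indicator (s i -` {c}) x)" for x
      proof -
        have "(\<Sum>c\<in>range (s i) - {0}. c * indicator (s i -` {c}) x)
            = (\<Sum>c\<in>range (s i) - {0}. if c = s i x then c else 0)"
          by (intro sum.cong) (auto simp: indicator_def)
        then show ?thesis using fin by simp
      qed
      have "(\<lambda>x. \<Sum>c\<in>range (s i) - {0}. c * indicator (s i -` {c}) x) \<in> test_closure"
      proof (intro test_closure_sum test_closure_scale test_closure_indicator)
        fix c assume c: "c \<in> range (s i) - {0}"
        show meas: "s i -` {c} \<in> sets borel"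
          using s(1)[of i] c by (auto simp: simple_function_def)
        \<comment> \<open>Chebyshev: |c|^2 times the measure of the level set is at most the
          integral of |s i|^2, and c is nonzero.\<close>
        have "ennreal ((cmod c)\<^sup>2) * emeasure lborel (s i -` {c})
            = (\<integral>\<^sup>+x. ennreal ((cmod c)\<^sup>2) * indicator (s i -` {c}) x \<partial>lborel)"
          using meas by (simp add: nn_integral_cmult_indicator)
        also have "\<dots> \<le> (\<integral>\<^sup>+x. ennreal ((cmod (s i x))\<^sup>2) \<partial>lborel)"
          by (intro nn_integral_mono) (auto simp: indicator_def)
        also have "\<dots> < \<infinity>"
          unfolding nn_integral_L2_norm[OF sL] by simp
        finally show "emeasure lborel (s i -` {c}) < \<infinity>"
          using c by (auto simp: ennreal_mult_less_top)
      qed (use fin in auto)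
      then show ?thesis unfolding eq[symmetric] .
    qed
    then show "f \<in> test_closure"
      by (rule test_closure_limit[OF _ f L2_dominated_convergence(3)[OF f sm _ ae]]) measurable
  qed
qed (auto simp: test_closureD)

subsection \<open>The Fourier transform as a unitary map\<close>

lemma L2_approx_test_functions:
  assumes "f \<in> L2"
  obtains \<phi> where "\<And>n. \<phi> n \<in> test_functions" "\<And>n. L2_norm (\<lambda>x. \<phi> n x - f x) < (1 / 2) ^ n"
  using test_closure_approx[of f] assms by (auto simp: test_closure_eq_L2)

text \<open>The pairing is bilinear, so the conjugate h of f - g turns it into an inner product with
  h. Test functions approximating h itself then force its norm to vanish.\<close>

lemma L2_eq_AE_if_test_functions:
  assumes f: "f \<in> L2" and g: "g \<in> L2"
    and eq: "\<And>\<psi>. \<psi> \<in> test_functions \<Longrightarrow> (LINT x|lborel. f x * \<psi> x) = (LINT x|lborel. g x * \<psi> x)"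
  shows "AE x in lborel. f x = g x"
proof -
  define h where "h x = cnj (f x - g x)" for x
  have h: "h \<in> L2" unfolding h_def[abs_def] by (intro L2_cnj L2_diff f g)
  obtain \<phi> where \<phi>: "\<And>n. \<phi> n \<in> test_functions" "\<And>n. L2_norm (\<lambda>x. \<phi> n x - h x) < (1 / 2) ^ n"
    using L2_approx_test_functions[OF h] by blast
  have "L2_inner (\<phi> n) h = 0" for n
  proof -
    have "L2_inner (\<phi> n) h = (LINT x|lborel. f x * \<phi> n x - g x * \<phi> n x)"
      unfolding L2_inner_def h_def by (simp add: right_diff_distrib mult.commute)
    then show ?thesis
      using eq[OF \<phi>(1)] f g by (simp add: L2_integrable_mult test_function_L2 \<phi>(1))
  qed
  moreover have "(\<lambda>n. L2_inner (\<phi> n) h) \<longlonglongrightarrow> L2_inner h h"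
    by (intro L2_inner_tendsto_left test_function_L2 \<phi>(1) h half_power_tendsto_0 \<phi>(2)) simp
  ultimately have "L2_inner h h = 0"
    by (simp add: LIMSEQ_const_iff)
  then have "AE x in lborel. h x = 0"
    unfolding L2_inner_self using L2_norm_eq_0_iff[OF h] by simp
  then show ?thesis by eventually_elim (simp add: h_def)
qed

lemma test_functions_diff: "f \<in> test_functions \<Longrightarrow> g \<in> test_functions \<Longrightarrow> (\<lambda>x. f x - g x) \<in> test_functions"
  using test_functions_add[OF _ test_functions_scale[of g "-1"], of f] by simp

lemma plancherel_test_function_diff:
  assumes "\<phi> \<in> test_functions" "\<psi> \<in> test_functions"
  shows "L2_norm (\<lambda>\<xi>. fourier_integral \<phi> \<xi> - fourier_integral \<psi> \<xi>) = L2_norm (\<lambda>x. \<phi> x - \<psi> x)"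
proof -
  have "fourier_integral (\<lambda>x. \<phi> x - \<psi> x) = (\<lambda>\<xi>. fourier_integral \<phi> \<xi> - fourier_integral \<psi> \<xi>)"
  proof
    fix \<xi>
    show "fourier_integral (\<lambda>x. \<phi> x - \<psi> x) \<xi> = fourier_integral \<phi> \<xi> - fourier_integral \<psi> \<xi>"
      using fourier_integral_add[of \<phi> "\<lambda>x. -1 * \<psi> x" \<xi>] fourier_integral_scale[of "-1" \<psi> \<xi>] assms
      by (simp add: test_functions_def)
  qed
  then show ?thesis
    using plancherel_test_function(2)[OF test_functions_diff[OF assms]] by simp
qed

text \<open>The transforms of a rapidly converging sequence of test functions are the partial sums
  of a telescoping series with geometrically small terms, which \<open>L2_series\<close> sums. The
  norm is recorded for this particular g; for an arbitrary one it has to await uniqueness.\<close>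

lemma L2_fourier_exists:
  assumes f: "f \<in> L2"
  shows "\<exists>g. (f, g) \<in> L2_fourier \<and> L2_norm g = L2_norm f"
proof -
  obtain \<phi> where \<phi>: "\<And>n. \<phi> n \<in> test_functions" "\<And>n. L2_norm (\<lambda>x. \<phi> n x - f x) < (1 / 2) ^ n"
    using L2_approx_test_functions[OF f] by blast
  define \<Phi> where "\<Phi> n = fourier_integral (\<phi> n)" for n
  have \<Phi>: "\<Phi> n \<in> L2" "L2_norm (\<Phi> n) = L2_norm (\<phi> n)" for n
    unfolding \<Phi>_def by (rule plancherel_test_function[OF \<phi>(1)])+
  have \<phi>L: "\<phi> n \<in> L2" for n by (rule test_function_L2[OF \<phi>(1)])
  define h where "h n x = \<Phi> (Suc n) x - \<Phi> n x" for n x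
  have h: "h n \<in> L2" for n unfolding h_def[abs_def] by (intro L2_diff \<Phi>)
  have "L2_norm (h n) \<le> 2 * (1 / 2) ^ n" for n
  proof -
    have "L2_norm (h n) = L2_norm (\<lambda>x. \<phi> (Suc n) x - \<phi> n x)"
      unfolding h_def[abs_def] \<Phi>_def by (rule plancherel_test_function_diff[OF \<phi>(1) \<phi>(1)])
    also have "\<dots> \<le> L2_norm (\<lambda>x. \<phi> (Suc n) x - f x) + L2_norm (\<lambda>x. f x - \<phi> n x)"
      by (intro L2_norm_triangle_diff \<phi>L f)
    also have "\<dots> \<le> (1 / 2) ^ Suc n + (1 / 2) ^ n"
      using \<phi>(2)[of "Suc n"] \<phi>(2)[of n] by (simp add: L2_norm_minus_commute[of f])
    finally show ?thesis
      using zero_le_power[of "1 / 2 :: real" n] unfolding power_Suc by linarith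
  qed
  then have "summable (\<lambda>n. L2_norm (h n))"
    by (intro summable_comparison_test[OF _ summable_mult[OF complete_algebra_summable_geometric[of "1 / 2 :: real"], of 2]])
      auto
  note h_series = L2_series[OF h this]
  define g where "g x = \<Phi> 0 x + (\<Sum>n. h n x)" for x
  have g: "g \<in> L2" unfolding g_def[abs_def] by (intro L2_add \<Phi> h_series)
  have tele: "(\<Sum>n<N. h n x) = \<Phi> N x - \<Phi> 0 x" for N x
    unfolding h_def by (rule sum_lessThan_telescope)
  have lim: "(\<lambda>n. L2_norm (\<lambda>\<xi>. \<Phi> n \<xi> - g \<xi>)) \<longlonglongrightarrow> 0"
    using h_series(3) unfolding tele g_def by (simp add: diff_diff_eq)
  have lim': "(\<lambda>n. L2_norm (\<lambda>x. \<phi> n x - f x)) \<longlonglongrightarrow> 0"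
    by (rule half_power_tendsto_0[OF \<phi>(2)]) simp
  have "integrable lborel (\<phi> n)" for n using \<phi>(1)[of n] by (simp add: test_functions_def)
  then have "(f, g) \<in> L2_fourier"
    unfolding L2_fourier_def using f g \<phi>L \<Phi>(1) lim lim' unfolding \<Phi>_def by blast
  moreover have "L2_norm g = L2_norm f"
    using LIMSEQ_unique[OF L2_norm_tendsto[OF \<Phi>(1) g lim]] L2_norm_tendsto[OF \<phi>L f lim']
    by (simp add: \<Phi>(2))
  ultimately show ?thesis by blast
qed

lemma L2_fourierD: "(f, g) \<in> L2_fourier \<Longrightarrow> f \<in> L2" "(f, g) \<in> L2_fourier \<Longrightarrow> g \<in> L2"
  by (auto simp: L2_fourier_def)

lemma L2_fourier_weak:
  assumes fg: "(f, g) \<in> L2_fourier" and \<psi>: "\<psi> \<in> test_functions"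
  shows "(LINT x|lborel. g x * \<psi> x) = (LINT x|lborel. f x * fourier_integral \<psi> x)"
proof -
  from fg obtain \<phi> where \<phi>: "\<And>n. \<phi> n \<in> L2" "\<And>n. integrable lborel (\<phi> n)" "\<And>n. fourier_integral (\<phi> n) \<in> L2"
    "(\<lambda>n. L2_norm (\<lambda>x. \<phi> n x - f x)) \<longlonglongrightarrow> 0"
    "(\<lambda>n. L2_norm (\<lambda>\<xi>. fourier_integral (\<phi> n) \<xi> - g \<xi>)) \<longlonglongrightarrow> 0"
    by (auto simp: L2_fourier_def)
  let ?l = "\<lambda>x. cnj (\<psi> x)" and ?r = "\<lambda>x. cnj (fourier_integral \<psi> x)"
  have l: "?l \<in> L2" and r: "?r \<in> L2"
    by (intro L2_cnj test_function_L2 plancherel_test_function \<psi>)+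
  have "L2_inner (fourier_integral (\<phi> n)) ?l = L2_inner (\<phi> n) ?r" for n
    using fourier_integral_multiplication[OF \<phi>(2)[of n], of \<psi>] \<psi>
    by (simp add: L2_inner_def test_functions_def)
  then have "L2_inner g ?l = L2_inner f ?r"
    using LIMSEQ_unique[OF L2_inner_tendsto_left[OF \<phi>(3) L2_fourierD(2)[OF fg] l \<phi>(5)]]
      L2_inner_tendsto_left[OF \<phi>(1) L2_fourierD(1)[OF fg] r \<phi>(4)]
    by simp
  then show ?thesis by (simp add: L2_inner_def)
qed

lemma L2_fourier_unique:
  assumes "(f, g) \<in> L2_fourier" "(f, g') \<in> L2_fourier"
  shows "AE x in lborel. g x = g' x"
  by (rule L2_eq_AE_if_test_functions) (use assms in \<open>simp_all add: L2_fourierD L2_fourier_weak\<close>)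

text \<open>Plancherel's identity is available for test functions only, while
  \<open>L2_fourier\<close> admits other approximating sequences. Hence the detour: the norm is
  known for one transform of f, and transforms are unique.\<close>

lemma L2_fourier_norm:
  assumes "(f, g) \<in> L2_fourier"
  shows "L2_norm g = L2_norm f"
proof -
  obtain g' where g': "(f, g') \<in> L2_fourier" "L2_norm g' = L2_norm f"
    using L2_fourier_exists[OF L2_fourierD(1)[OF assms]] by blast
  have "L2_norm g = L2_norm g'"
    by (intro L2_norm_cong_AE L2_fourier_unique[OF assms g'(1)] L2_measurable
        L2_fourierD(2)[OF assms] L2_fourierD(2)[OF g'(1)])
  then show ?thesis using g'(2) by simp
qed

lemma L2_fourier_cong_right:
  assumes fg: "(f, g) \<in> L2_fourier" and "AE x in lborel. g x = g' x" "g' \<in> L2"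
  shows "(f, g') \<in> L2_fourier"
proof -
  from fg obtain \<phi> where \<phi>: "\<And>n. \<phi> n \<in> L2" "\<And>n. integrable lborel (\<phi> n)" "\<And>n. fourier_integral (\<phi> n) \<in> L2"
    "(\<lambda>n. L2_norm (\<lambda>x. \<phi> n x - f x)) \<longlonglongrightarrow> 0"
    "(\<lambda>n. L2_norm (\<lambda>\<xi>. fourier_integral (\<phi> n) \<xi> - g \<xi>)) \<longlonglongrightarrow> 0"
    by (auto simp: L2_fourier_def)
  have "L2_norm (\<lambda>\<xi>. fourier_integral (\<phi> n) \<xi> - g \<xi>) = L2_norm (\<lambda>\<xi>. fourier_integral (\<phi> n) \<xi> - g' \<xi>)" for n
    by (rule L2_norm_cong_AE)
      (use assms(2) in \<open>auto intro!: L2_measurable[OF L2_diff] \<phi> assms L2_fourierD(2)[OF fg]\<close>)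
  with \<phi>(5) have "(\<lambda>n. L2_norm (\<lambda>\<xi>. fourier_integral (\<phi> n) \<xi> - g' \<xi>)) \<longlonglongrightarrow> 0" by simp
  then show ?thesis
    unfolding L2_fourier_def using \<phi>(1-4) L2_fourierD(1)[OF fg] assms(3) by blast
qed

text \<open>A transform of f exists, and the pairing with test functions identifies it with g. The
  right-hand side is linear and free of approximating sequences, which makes sums, multiples,
  changes on null sets and the inverse transform accessible.\<close>

lemma L2_fourier_iff:
  "(f, g) \<in> L2_fourier \<longleftrightarrow> f \<in> L2 \<and> g \<in> L2 \<and>
    (\<forall>\<psi>\<in>test_functions. (LINT x|lborel. g x * \<psi> x) = (LINT x|lborel. f x * fourier_integral \<psi> x))"
proof
  assume *: "f \<in> L2 \<and> g \<in> L2 \<and>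
    (\<forall>\<psi>\<in>test_functions. (LINT x|lborel. g x * \<psi> x) = (LINT x|lborel. f x * fourier_integral \<psi> x))"
  then obtain g' where g': "(f, g') \<in> L2_fourier"
    using L2_fourier_exists by blast
  have "AE x in lborel. g' x = g x"
    by (rule L2_eq_AE_if_test_functions) (use * L2_fourier_weak[OF g'] L2_fourierD[OF g'] in auto)
  then show "(f, g) \<in> L2_fourier"
    using L2_fourier_cong_right[OF g'] * by blast
qed (use L2_fourier_weak L2_fourierD in blast)

lemma L2_fourier_cong_left:
  assumes fg: "(f, g) \<in> L2_fourier" and ae: "AE x in lborel. f x = f' x" and f': "f' \<in> L2"
  shows "(f', g) \<in> L2_fourier"
proof -
  have "(LINT x|lborel. f x * fourier_integral \<psi> x) = (LINT x|lborel. f' x * fourier_integral \<psi> x)"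
    if "\<psi> \<in> test_functions" for \<psi>
  proof (rule integral_cong_AE)
    have "fourier_integral \<psi> \<in> L2" using that by (rule plancherel_test_function)
    then show "(\<lambda>x. f x * fourier_integral \<psi> x) \<in> borel_measurable lborel"
      "(\<lambda>x. f' x * fourier_integral \<psi> x) \<in> borel_measurable lborel"
      using L2_fourierD(1)[OF fg] f'
      by (auto intro!: borel_measurable_times dest!: L2_measurable)
  qed (use ae in auto)
  then show ?thesis
    using fg f' by (simp add: L2_fourier_iff)
qed

section \<open>Linearity, isometry and invertibility of the transform\<close>

lemma L2_fourier_add:
  assumes "(f, g) \<in> L2_fourier" "(f', g') \<in> L2_fourier"
  shows "(\<lambda>x. f x + f' x, \<lambda>\<xi>. g \<xi> + g' \<xi>) \<in> L2_fourier"
  using assms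
  by (simp add: L2_fourier_iff L2_add distrib_right L2_integrable_mult test_function_L2
      plancherel_test_function)

lemma L2_fourier_scale:
  assumes "(f, g) \<in> L2_fourier"
  shows "(\<lambda>x. c * f x, \<lambda>\<xi>. c * g \<xi>) \<in> L2_fourier"
  using assms by (simp add: L2_fourier_iff L2_scale mult.assoc)

lemma L2_fourier_diff:
  assumes "(f, g) \<in> L2_fourier" "(f', g') \<in> L2_fourier"
  shows "(\<lambda>x. f x - f' x, \<lambda>\<xi>. g \<xi> - g' \<xi>) \<in> L2_fourier"
  using L2_fourier_add[OF assms(1) L2_fourier_scale[OF assms(2), of "-1"]] by simp

lemma L2_fourier_sum:
  assumes "\<And>i. i \<in> I \<Longrightarrow> (f i, g i) \<in> L2_fourier"
  shows "(\<lambda>x. \<Sum>i\<in>I. f i x, \<lambda>\<xi>. \<Sum>i\<in>I. g i \<xi>) \<in> L2_fourier"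
  using assms
proof (induction I rule: infinite_finite_induct)
  case (insert i I)
  then show ?case by (simp add: L2_fourier_add)
qed (simp_all add: L2_fourier_iff)

lemma L2_fourier_inner:
  assumes "(f, g) \<in> L2_fourier" "(f', g') \<in> L2_fourier"
  shows "L2_inner g g' = L2_inner f f'"
proof -
  have "L2_norm (\<lambda>x. g x + c * g' x) = L2_norm (\<lambda>x. f x + c * f' x)" for c
    by (rule L2_fourier_norm[OF L2_fourier_add[OF assms(1) L2_fourier_scale[OF assms(2)]]])
  then have "4 * L2_inner g g' = 4 * L2_inner f f'"
    by (simp only: L2_polarization[OF L2_fourierD(2)[OF assms(1)] L2_fourierD(2)[OF assms(2)]]
        L2_polarization[OF L2_fourierD(1)[OF assms(1)] L2_fourierD(1)[OF assms(2)]])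
  then show ?thesis by simp
qed

lemma L2_fourier_injective:
  assumes "(f, g) \<in> L2_fourier" "(f', g) \<in> L2_fourier"
  shows "AE x in lborel. f x = f' x"
proof -
  note d = L2_fourier_diff[OF assms]
  have "L2_norm (\<lambda>x. f x - f' x) = 0"
    using L2_fourier_norm[OF d] by simp
  then show ?thesis
    using L2_norm_eq_0_iff[OF L2_fourierD(1)[OF d]] by simp
qed

lemma test_function_L2_fourier:
  assumes "\<psi> \<in> test_functions"
  shows "(\<psi>, fourier_integral \<psi>) \<in> L2_fourier"
  using assms fourier_integral_multiplication[of \<psi>]
  by (auto simp: L2_fourier_iff test_function_L2 plancherel_test_function test_functions_def)

text \<open>The inverse transform is the transform conjugated by complex conjugation.\<close>

lemma L2_fourier_surjective:
  assumes g: "g \<in> L2"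
  shows "\<exists>f. (f, g) \<in> L2_fourier"
proof -
  obtain h where h: "(\<lambda>x. cnj (g x), h) \<in> L2_fourier"
    using L2_fourier_exists[OF L2_cnj[OF g]] by blast
  \<comment> \<open>Preservation of inner products, applied to the test function and to the
    conjugate of g, is exactly the weak description of the pair formed by the conjugate of h and
    g.\<close>
  have "(LINT x|lborel. g x * \<psi> x) = (LINT x|lborel. cnj (h x) * fourier_integral \<psi> x)"
    if "\<psi> \<in> test_functions" for \<psi>
    using L2_fourier_inner[OF test_function_L2_fourier[OF that] h]
    by (simp add: L2_inner_def mult.commute)
  then have "(\<lambda>x. cnj (h x), g) \<in> L2_fourier"
    using g L2_fourierD(2)[OF h] by (simp add: L2_fourier_iff L2_cnj)
  then show ?thesis by blast
qed

subsection \<open>Spectral calculus of real Fourier multipliers\<close>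

text \<open>\<open>projection_valued_measure\<close> speaks of functions while the transform is a
  graph, so a representative has to be picked. Only its membership in the graph is used.\<close>

definition L2_fourier_of :: "('a::euclidean_space \<Rightarrow> complex) \<Rightarrow> ('a \<Rightarrow> complex)" where
  "L2_fourier_of f = (SOME g. (f, g) \<in> L2_fourier)"

definition L2_fourier_inv :: "('a::euclidean_space \<Rightarrow> complex) \<Rightarrow> ('a \<Rightarrow> complex)" where
  "L2_fourier_inv g = (SOME f. (f, g) \<in> L2_fourier)"

lemma L2_fourier_of: "f \<in> L2 \<Longrightarrow> (f, L2_fourier_of f) \<in> L2_fourier"
  unfolding L2_fourier_of_def using L2_fourier_exists by (metis someI_ex)

lemma L2_fourier_of_L2: "f \<in> L2 \<Longrightarrow> L2_fourier_of f \<in> L2"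
  by (rule L2_fourierD(2)[OF L2_fourier_of])

lemma L2_fourier_inv: "g \<in> L2 \<Longrightarrow> (L2_fourier_inv g, g) \<in> L2_fourier"
  unfolding L2_fourier_inv_def using L2_fourier_surjective by (metis someI_ex)

definition multiplier_pvm ::
    "('a::euclidean_space \<Rightarrow> real) \<Rightarrow> real set \<Rightarrow> ('a \<Rightarrow> complex) \<Rightarrow> ('a \<Rightarrow> complex)" where
  "multiplier_pvm m B f = L2_fourier_inv (\<lambda>\<xi>. indicator B (m \<xi>) * L2_fourier_of f \<xi>)"

context
  fixes m :: "'a::euclidean_space \<Rightarrow> real"
  assumes m [measurable]: "m \<in> borel_measurable borel"
begin

lemma L2_indicator_mult:
  assumes "B \<in> sets borel" "F \<in> L2"
  shows "(\<lambda>\<xi>. indicator B (m \<xi>) * F \<xi>) \<in> L2"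
proof (rule L2_mult_bounded[OF assms(2), where C = 1])
  note [measurable] = assms(1)
  show "(\<lambda>\<xi>. indicator B (m \<xi>)) \<in> borel_measurable borel" by measurable
qed (simp add: indicator_def)

text \<open>Frees \<open>multiplier_pvm\<close> from the chosen transform: any F paired with f will
  do, since two transforms agree almost everywhere. The properties below are derived from this
  membership.\<close>

lemma L2_fourier_multiplier_pvm:
  assumes f: "(f, F) \<in> L2_fourier" and B: "B \<in> sets borel"
  shows "(multiplier_pvm m B f, \<lambda>\<xi>. indicator B (m \<xi>) * F \<xi>) \<in> L2_fourier"
proof (rule L2_fourier_cong_right)
  note f' = L2_fourier_of[OF L2_fourierD(1)[OF f]]
  show "(multiplier_pvm m B f, \<lambda>\<xi>. indicator B (m \<xi>) * L2_fourier_of f \<xi>) \<in> L2_fourier"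
    unfolding multiplier_pvm_def
    by (intro L2_fourier_inv L2_indicator_mult B L2_fourierD(2)[OF f'])
  show "AE \<xi> in lborel. indicator B (m \<xi>) * L2_fourier_of f \<xi> = indicator B (m \<xi>) * F \<xi>"
    using L2_fourier_unique[OF f' f] by eventually_elim simp
  show "(\<lambda>\<xi>. indicator B (m \<xi>) * F \<xi>) \<in> L2"
    by (intro L2_indicator_mult B L2_fourierD(2)[OF f])
qed

lemma L2_multiplier_pvm: "f \<in> L2 \<Longrightarrow> B \<in> sets borel \<Longrightarrow> multiplier_pvm m B f \<in> L2"
  by (rule L2_fourierD(1)[OF L2_fourier_multiplier_pvm[OF L2_fourier_of]])

lemma multiplier_pvm_Int:
  assumes "B \<in> sets borel" "C \<in> sets borel" "f \<in> L2"
  shows "AE x in lborel. multiplier_pvm m (B \<inter> C) f x = multiplier_pvm m B (multiplier_pvm m C f) x"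
proof (rule L2_fourier_injective)
  note f = L2_fourier_of[OF assms(3)]
  show "(multiplier_pvm m (B \<inter> C) f, \<lambda>\<xi>. indicator (B \<inter> C) (m \<xi>) * L2_fourier_of f \<xi>) \<in> L2_fourier"
    by (intro L2_fourier_multiplier_pvm f sets.Int assms)
  show "(multiplier_pvm m B (multiplier_pvm m C f), \<lambda>\<xi>. indicator (B \<inter> C) (m \<xi>) * L2_fourier_of f \<xi>) \<in> L2_fourier"
    using L2_fourier_multiplier_pvm[OF L2_fourier_multiplier_pvm[OF f assms(2)] assms(1)]
    by (simp add: indicator_inter_arith mult.assoc)
qed

lemma L2_inner_multiplier_pvm:
  assumes "(f, F) \<in> L2_fourier" "(g, G) \<in> L2_fourier" "B \<in> sets borel"
  shows "L2_inner (multiplier_pvm m B f) g = L2_inner (\<lambda>\<xi>. indicator B (m \<xi>) * F \<xi>) G"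
    and "L2_inner f (multiplier_pvm m B g) = L2_inner (\<lambda>\<xi>. indicator B (m \<xi>) * F \<xi>) G"
proof -
  show "L2_inner (multiplier_pvm m B f) g = L2_inner (\<lambda>\<xi>. indicator B (m \<xi>) * F \<xi>) G"
    by (rule L2_fourier_inner[OF L2_fourier_multiplier_pvm[OF assms(1,3)] assms(2), symmetric])
  have "cnj (indicator B x) = (indicator B x :: complex)" for x :: real
    by (simp add: indicator_def)
  then have "L2_inner F (\<lambda>\<xi>. indicator B (m \<xi>) * G \<xi>) = L2_inner (\<lambda>\<xi>. indicator B (m \<xi>) * F \<xi>) G"
    unfolding L2_inner_def by (simp add: mult_ac)
  then show "L2_inner f (multiplier_pvm m B g) = L2_inner (\<lambda>\<xi>. indicator B (m \<xi>) * F \<xi>) G"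
    using L2_fourier_inner[OF assms(1) L2_fourier_multiplier_pvm[OF assms(2,3)]] by simp
qed

text \<open>The isometry moves the claim to the Fourier side. There at most one summand is nonzero
  at each frequency, and dominated convergence applies with the transform of f as majorant.\<close>

lemma multiplier_pvm_sigma_additive:
  fixes B :: "nat \<Rightarrow> real set"
  assumes B: "range B \<subseteq> sets borel" "disjoint_family B" and f: "f \<in> L2"
  shows "(\<lambda>n. L2_norm (\<lambda>x. (\<Sum>i<n. multiplier_pvm m (B i) f x) - multiplier_pvm m (\<Union>i. B i) f x)) \<longlonglongrightarrow> 0"
proof -
  note fF = L2_fourier_of[OF f]
  let ?F = "L2_fourier_of f"
  have [measurable]: "?F \<in> borel_measurable borel"
    by (rule L2_measurable[OF L2_fourier_of_L2[OF f]])
  have B' [measurable]: "B i \<in> sets borel" for i using B(1) by auto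
  have [measurable]: "(\<Union>i. B i) \<in> sets borel" by (rule sets.countable_UN[OF B(1)])
  have "(\<lambda>n. L2_norm (\<lambda>\<xi>. (\<Sum>i<n. indicator (B i) (m \<xi>) * ?F \<xi>) - indicator (\<Union>i. B i) (m \<xi>) * ?F \<xi>)) \<longlonglongrightarrow> 0"
  proof (rule L2_dominated_convergence(3)[OF L2_fourier_of_L2[OF f], where C = 1])
    show "AE \<xi> in lborel. (\<lambda>n. \<Sum>i<n. indicator (B i) (m \<xi>) * ?F \<xi>)
        \<longlonglongrightarrow> indicator (\<Union>i. B i) (m \<xi>) * ?F \<xi>"
    proof (rule AE_I2)
      fix \<xi>
      have "(\<lambda>i. indicator (B i) (m \<xi>) * ?F \<xi>) sums (indicator (\<Union>i. B i) (m \<xi>) * ?F \<xi>)"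
      proof (cases "m \<xi> \<in> (\<Union>i. B i)")
        case True
        then obtain k where k: "m \<xi> \<in> B k" by blast
        then have "m \<xi> \<notin> B i" if "i \<noteq> k" for i
          using disjoint_family_onD[OF B(2), of i k] that by auto
        then have "(\<lambda>i. indicator (B i) (m \<xi>) * ?F \<xi>) = (\<lambda>i. if i = k then ?F \<xi> else 0)"
          using k by (auto simp: indicator_def)
        then show ?thesis using True sums_single[of k "\<lambda>_. ?F \<xi>"] by simp
      next
        case False
        then show ?thesis by simp
      qed
      then show "(\<lambda>n. \<Sum>i<n. indicator (B i) (m \<xi>) * ?F \<xi>) \<longlonglongrightarrow> indicator (\<Union>i. B i) (m \<xi>) * ?F \<xi>"
        by (simp add: sums_def)
    qed
    show "AE \<xi> in lborel. \<forall>n. cmod (\<Sum>i<n. indicator (B i) (m \<xi>) * ?F \<xi>) \<le> 1 * cmod (?F \<xi>)"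
    proof (intro AE_I2 allI)
      fix \<xi> n
      have "(\<Sum>i<n. indicator (B i) (m \<xi>) :: complex) = indicator (\<Union>i<n. B i) (m \<xi>)"
        by (rule indicator_UN_disjoint[symmetric])
          (use B(2) in \<open>auto intro: disjoint_family_on_mono[of "{..<n}" UNIV]\<close>)
      then show "cmod (\<Sum>i<n. indicator (B i) (m \<xi>) * ?F \<xi>) \<le> 1 * cmod (?F \<xi>)"
        unfolding sum_distrib_right[symmetric] by (simp add: norm_mult indicator_def)
    qed
  qed measurable
  moreover have "L2_norm (\<lambda>\<xi>. (\<Sum>i<n. indicator (B i) (m \<xi>) * ?F \<xi>) - indicator (\<Union>i. B i) (m \<xi>) * ?F \<xi>)
      = L2_norm (\<lambda>x. (\<Sum>i<n. multiplier_pvm m (B i) f x) - multiplier_pvm m (\<Union>i. B i) f x)" for n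
    by (intro L2_fourier_norm L2_fourier_diff L2_fourier_sum L2_fourier_multiplier_pvm fF) auto
  ultimately show ?thesis by simp
qed

lemma projection_valued_measure_multiplier_pvm: "projection_valued_measure (multiplier_pvm m)"
  unfolding projection_valued_measure_def
proof (intro conjI ballI allI impI)
  fix B :: "real set" assume B: "B \<in> sets borel"
  show "L2_projection (multiplier_pvm m B)"
    unfolding L2_projection_def
  proof (intro conjI ballI)
    fix f :: "'a \<Rightarrow> complex" assume f: "f \<in> L2"
    show "multiplier_pvm m B f \<in> L2" by (rule L2_multiplier_pvm[OF f B])
    show "AE x in lborel. multiplier_pvm m B (multiplier_pvm m B f) x = multiplier_pvm m B f x"
      using multiplier_pvm_Int[OF B B f] by eventually_elim simp
    fix g :: "'a \<Rightarrow> complex" assume g: "g \<in> L2"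
    show "L2_inner (multiplier_pvm m B f) g = L2_inner f (multiplier_pvm m B g)"
      using L2_inner_multiplier_pvm[OF L2_fourier_of[OF f] L2_fourier_of[OF g] B] by simp
  qed
next
  fix f :: "'a \<Rightarrow> complex" assume f: "f \<in> L2"
  show "AE x in lborel. multiplier_pvm m UNIV f x = f x"
    by (rule L2_fourier_injective[OF L2_fourier_multiplier_pvm[OF L2_fourier_of[OF f]]])
      (use L2_fourier_of[OF f] in simp_all)
qed (auto intro: multiplier_pvm_Int multiplier_pvm_sigma_additive)

text \<open>By preservation of inner products the mass of B is the integral of |F|^2 over m^-1(B).
  Integrals against the spectral measure thereby become Lebesgue integrals.\<close>

lemma scalar_spectral_measure_multiplier_pvm:
  assumes f: "(f, F) \<in> L2_fourier"
  shows "scalar_spectral_measure (multiplier_pvm m) f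
    = distr (density lborel (\<lambda>\<xi>. ennreal ((cmod (F \<xi>))\<^sup>2))) borel m"
proof -
  have F: "F \<in> L2" by (rule L2_fourierD(2)[OF f])
  have [measurable]: "F \<in> borel_measurable borel" by (rule L2_measurable[OF F])
  let ?N = "distr (density lborel (\<lambda>\<xi>. ennreal ((cmod (F \<xi>))\<^sup>2))) borel m"
  have "ennreal (Re (L2_inner (multiplier_pvm m B f) f)) = emeasure ?N B" if [measurable]: "B \<in> sets borel" for B
  proof -
    have "L2_inner (\<lambda>\<xi>. indicator B (m \<xi>) * F \<xi>) F
        = (LINT \<xi>|lborel. complex_of_real ((cmod (F \<xi>))\<^sup>2 * indicator B (m \<xi>)))"
      unfolding L2_inner_def
      by (intro Bochner_Integration.integral_cong refl)
        (simp add: mult.assoc complex_norm_square[symmetric] indicator_def)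
    then have "Re (L2_inner (multiplier_pvm m B f) f) = (LINT \<xi>|lborel. (cmod (F \<xi>))\<^sup>2 * indicator B (m \<xi>))"
      unfolding L2_inner_multiplier_pvm(1)[OF f f that] integral_complex_of_real by simp
    moreover have "integrable lborel (\<lambda>\<xi>. (cmod (F \<xi>))\<^sup>2 * indicator B (m \<xi>))"
      by (rule Bochner_Integration.integrable_bound[OF L2_integrable_square[OF F]])
        (auto simp: indicator_def)
    ultimately have "ennreal (Re (L2_inner (multiplier_pvm m B f) f))
        = (\<integral>\<^sup>+\<xi>. ennreal ((cmod (F \<xi>))\<^sup>2 * indicator B (m \<xi>)) \<partial>lborel)"
      by (simp add: nn_integral_eq_integral)
    also have "\<dots> = (\<integral>\<^sup>+\<xi>. ennreal ((cmod (F \<xi>))\<^sup>2) * indicator (m -` B) \<xi> \<partial>lborel)"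
      by (intro nn_integral_cong) (auto simp: indicator_def)
    also have "\<dots> = emeasure ?N B"
      by (simp add: emeasure_distr emeasure_density measurable_sets_borel[OF m that])
    finally show ?thesis .
  qed
  \<comment> \<open>\<open>measure_of\<close> depends only on the values on Borel sets; that these
    define a measure comes from their being the values of \<open>?N\<close>.\<close>
  then have "scalar_spectral_measure (multiplier_pvm m) f = measure_of UNIV (sets borel) (emeasure ?N)"
    unfolding scalar_spectral_measure_def
    by (intro measure_of_eq) (auto simp: sets.sigma_sets_eq[of borel, simplified])
  then show ?thesis
    using measure_of_of_measure[of ?N] by simp
qed

lemma nn_integral_scalar_spectral_measure:
  assumes f: "(f, F) \<in> L2_fourier" and u [measurable]: "u \<in> borel_measurable borel"
  shows "(\<integral>\<^sup>+l. ennreal ((cmod (u l))\<^sup>2) \<partial>scalar_spectral_measure (multiplier_pvm m) f)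
    = (\<integral>\<^sup>+\<xi>. ennreal ((cmod (u (m \<xi>) * F \<xi>))\<^sup>2) \<partial>lborel)"
proof -
  have [measurable]: "F \<in> borel_measurable borel" by (rule L2_measurable[OF L2_fourierD(2)[OF f]])
  show ?thesis
    unfolding scalar_spectral_measure_multiplier_pvm[OF f]
    by (simp add: nn_integral_distr nn_integral_density norm_mult power_mult_distrib ennreal_mult' mult.commute)
qed

lemma L2_fourier_simple_function:
  assumes f: "(f, F) \<in> L2_fourier" and \<sigma>: "simple_function borel \<sigma>"
  shows "(\<lambda>x. \<Sum>c\<in>range \<sigma>. c * multiplier_pvm m (\<sigma> -` {c}) f x, \<lambda>\<xi>. \<sigma> (m \<xi>) * F \<xi>) \<in> L2_fourier"
proof -
  have fin: "finite (range \<sigma>)" and meas: "\<sigma> -` {c} \<in> sets borel" if "c \<in> range \<sigma>" for c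
    using \<sigma> that by (auto simp: simple_function_def)
  have "\<sigma> (m \<xi>) * F \<xi> = (\<Sum>c\<in>range \<sigma>. c * (indicator (\<sigma> -` {c}) (m \<xi>) * F \<xi>))" for \<xi>
  proof -
    have "(\<Sum>c\<in>range \<sigma>. c * (indicator (\<sigma> -` {c}) (m \<xi>) * F \<xi>))
        = (\<Sum>c\<in>range \<sigma>. if c = \<sigma> (m \<xi>) then c * F \<xi> else 0)"
      by (intro sum.cong) (auto simp: indicator_def)
    then show ?thesis using fin[of "\<sigma> (m \<xi>)"] by simp
  qed
  then show ?thesis
    by (simp only:) (intro L2_fourier_sum L2_fourier_scale L2_fourier_multiplier_pvm f meas)
qed

text \<open>On the Fourier side a simple function sigma acts as multiplication by sigma(m), and
  distance in the spectral measure is the L2 distance of sigma(m) F to phi(m) F. The two limits in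
  \<open>spectral_integral\<close> thus say that one sequence tends both to phi(m) F and to the
  transform of g.\<close>

lemma spectral_integral_multiplier_pvm:
  assumes \<phi> [measurable]: "\<phi> \<in> borel_measurable borel"
  shows "spectral_integral (multiplier_pvm m) \<phi> = fourier_multiplier (\<lambda>\<xi>. \<phi> (m \<xi>))"
proof (intro equalityI subrelI)
  fix f g assume fg: "(f, g) \<in> spectral_integral (multiplier_pvm m) \<phi>"
  then have f: "f \<in> L2" and g: "g \<in> L2" by (auto simp: spectral_integral_def)
  define F G where "F = L2_fourier_of f" and "G = L2_fourier_of g"
  have fF: "(f, F) \<in> L2_fourier" and gG: "(g, G) \<in> L2_fourier"
    unfolding F_def G_def by (intro L2_fourier_of f g)+
  have [measurable]: "F \<in> borel_measurable borel" by (rule L2_measurable[OF L2_fourierD(2)[OF fF]])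
  obtain \<sigma> where \<sigma>: "\<And>n. simple_function borel (\<sigma> n)"
    and lim1: "(\<lambda>n. \<integral>\<^sup>+l. ennreal ((cmod (\<sigma> n l - \<phi> l))\<^sup>2) \<partial>scalar_spectral_measure (multiplier_pvm m) f) \<longlonglongrightarrow> 0"
    and lim2: "(\<lambda>n. L2_norm (\<lambda>x. (\<Sum>c\<in>range (\<sigma> n). c * multiplier_pvm m (\<sigma> n -` {c}) f x) - g x)) \<longlonglongrightarrow> 0"
    using fg by (auto simp: spectral_integral_def)
  have [measurable]: "\<sigma> n \<in> borel_measurable borel" for n
    by (rule borel_measurable_simple_function[OF \<sigma>])
  let ?S = "\<lambda>n \<xi>. \<sigma> n (m \<xi>) * F \<xi>" and ?H = "\<lambda>\<xi>. \<phi> (m \<xi>) * F \<xi>"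
  note S = L2_fourier_simple_function[OF fF \<sigma>]
  have SL: "?S n \<in> L2" for n by (rule L2_fourierD(2)[OF S])
  have lim2': "(\<lambda>n. L2_norm (\<lambda>\<xi>. ?S n \<xi> - G \<xi>)) \<longlonglongrightarrow> 0"
    using lim2 by (simp only: L2_fourier_norm[OF L2_fourier_diff[OF S gG]])
  have lim1': "(\<lambda>n. \<integral>\<^sup>+\<xi>. ennreal ((cmod (?S n \<xi> - ?H \<xi>))\<^sup>2) \<partial>lborel) \<longlonglongrightarrow> 0"
    using lim1 by (subst (asm) nn_integral_scalar_spectral_measure[OF fF]) (simp_all add: left_diff_distrib)
  then have "\<forall>\<^sub>F n in sequentially. (\<integral>\<^sup>+\<xi>. ennreal ((cmod (?S n \<xi> - ?H \<xi>))\<^sup>2) \<partial>lborel) < 1"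
    by (rule order_tendstoD) simp
  \<comment> \<open>That phi(m) F lies in L2 is not given. It follows from a single index at which
    its difference to the square-integrable approximant has finite norm.\<close>
  then obtain n where "(\<integral>\<^sup>+\<xi>. ennreal ((cmod (?S n \<xi> - ?H \<xi>))\<^sup>2) \<partial>lborel) < 1"
    by (auto simp: eventually_sequentially)
  then have "(\<lambda>\<xi>. ?S n \<xi> - ?H \<xi>) \<in> L2"
    by (intro L2_nn_integralI) (auto intro: order_less_trans)
  from L2_diff[OF SL[of n] this] have H: "?H \<in> L2" by simp
  have "(\<lambda>n. L2_norm (\<lambda>\<xi>. ?S n \<xi> - ?H \<xi>)) \<longlonglongrightarrow> 0"
  proof -
    have "(\<lambda>n. ennreal ((L2_norm (\<lambda>\<xi>. ?S n \<xi> - ?H \<xi>))\<^sup>2)) \<longlonglongrightarrow> ennreal 0"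
      using lim1' by (simp add: nn_integral_L2_norm[OF L2_diff[OF SL H]])
    then have "(\<lambda>n. (L2_norm (\<lambda>\<xi>. ?S n \<xi> - ?H \<xi>))\<^sup>2) \<longlonglongrightarrow> 0"
      by (subst (asm) tendsto_ennreal_iff) auto
    then have "(\<lambda>n. sqrt ((L2_norm (\<lambda>\<xi>. ?S n \<xi> - ?H \<xi>))\<^sup>2)) \<longlonglongrightarrow> sqrt 0"
      by (rule tendsto_real_sqrt)
    then show ?thesis by simp
  qed
  then have "AE \<xi> in lborel. G \<xi> = ?H \<xi>"
    by (rule L2_limit_unique[OF SL L2_fourierD(2)[OF gG] H lim2'])
  then have "(g, ?H) \<in> L2_fourier"
    by (rule L2_fourier_cong_right[OF gG _ H])
  then show "(f, g) \<in> fourier_multiplier (\<lambda>\<xi>. \<phi> (m \<xi>))"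
    using fF by (auto simp: fourier_multiplier_def)
next
  fix f g assume "(f, g) \<in> fourier_multiplier (\<lambda>\<xi>. \<phi> (m \<xi>))"
  then obtain F where fF: "(f, F) \<in> L2_fourier" and gH: "(g, \<lambda>\<xi>. \<phi> (m \<xi>) * F \<xi>) \<in> L2_fourier"
    by (auto simp: fourier_multiplier_def)
  have [measurable]: "F \<in> borel_measurable borel" by (rule L2_measurable[OF L2_fourierD(2)[OF fF]])
  note H = L2_fourierD(2)[OF gH]
  \<comment> \<open>Approximants of modulus at most 2 |phi| stay dominated by 2 |phi(m) F|, which is
    in L2 as the modulus of a transform of g.\<close>
  obtain \<sigma> where \<sigma>: "\<And>n. simple_function borel (\<sigma> n)" "\<And>l. (\<lambda>n. \<sigma> n l) \<longlonglongrightarrow> \<phi> l"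
    "\<And>n l. dist (\<sigma> n l) 0 \<le> 2 * dist (\<phi> l) 0"
    using borel_measurable_implies_sequence_metric[of \<phi> borel 0] by auto
  have [measurable]: "\<sigma> n \<in> borel_measurable borel" for n
    by (rule borel_measurable_simple_function[OF \<sigma>(1)])
  let ?S = "\<lambda>n \<xi>. \<sigma> n (m \<xi>) * F \<xi>" and ?H = "\<lambda>\<xi>. \<phi> (m \<xi>) * F \<xi>"
  have lim: "AE \<xi> in lborel. (\<lambda>n. ?S n \<xi>) \<longlonglongrightarrow> ?H \<xi>"
    by (intro AE_I2 tendsto_intros \<sigma>(2))
  have bound: "AE \<xi> in lborel. \<forall>n. cmod (?S n \<xi>) \<le> 2 * cmod (?H \<xi>)"
    using \<sigma>(3) by (intro AE_I2 allI) (simp add: norm_mult mult.assoc[symmetric] mult_right_mono)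
  have SL: "?S n \<in> L2" for n
    by (rule L2_dominated_convergence(2)[OF H _ _ lim bound]) measurable
  have L: "(\<lambda>n. L2_norm (\<lambda>\<xi>. ?S n \<xi> - ?H \<xi>)) \<longlonglongrightarrow> 0"
    by (rule L2_dominated_convergence(3)[OF H _ _ lim bound]) measurable
  have "(\<lambda>n. ennreal ((L2_norm (\<lambda>\<xi>. ?S n \<xi> - ?H \<xi>))\<^sup>2)) \<longlonglongrightarrow> ennreal (0\<^sup>2)"
    by (intro tendsto_ennrealI tendsto_intros L)
  then have "(\<lambda>n. \<integral>\<^sup>+l. ennreal ((cmod (\<sigma> n l - \<phi> l))\<^sup>2) \<partial>scalar_spectral_measure (multiplier_pvm m) f) \<longlonglongrightarrow> 0"
    by (subst nn_integral_scalar_spectral_measure[OF fF])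
      (simp_all add: left_diff_distrib nn_integral_L2_norm[OF L2_diff[OF SL H]])
  moreover have "(\<lambda>n. L2_norm (\<lambda>x. (\<Sum>c\<in>range (\<sigma> n). c * multiplier_pvm m (\<sigma> n -` {c}) f x) - g x)) \<longlonglongrightarrow> 0"
    using L by (simp only: L2_fourier_norm[OF L2_fourier_diff[OF L2_fourier_simple_function[OF fF \<sigma>(1)] gH]])
  ultimately show "(f, g) \<in> spectral_integral (multiplier_pvm m) \<phi>"
    using \<sigma>(1) L2_fourierD(1)[OF fF] L2_fourierD(1)[OF gH] by (auto simp: spectral_integral_def)
qed

lemma functional_calculus_fourier_multiplier:
  assumes "\<phi> \<in> borel_measurable borel"
    and "(f, g) \<in> fourier_multiplier (\<lambda>\<xi>. \<phi> (m \<xi>))"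
  shows "(f, g) \<in> functional_calculus \<phi> (fourier_multiplier (\<lambda>\<xi>. complex_of_real (m \<xi>)))"
proof -
  have "fourier_multiplier (\<lambda>\<xi>. complex_of_real (m \<xi>)) = spectral_integral (multiplier_pvm m) complex_of_real"
    by (rule spectral_integral_multiplier_pvm[symmetric]) measurable
  then show ?thesis
    using assms projection_valued_measure_multiplier_pvm spectral_integral_multiplier_pvm[OF assms(1)]
    by (auto simp: functional_calculus_def)
qed

end

subsection \<open>Continuity of the unitary group in the time variable\<close>

text \<open>By isometry the s n also converge to the inverse transform of g, and L2 limits are
  unique up to null sets.\<close>

lemma L2_fourier_closed:
  assumes "\<And>n. (s n, S n) \<in> L2_fourier" "f \<in> L2" "g \<in> L2"
    and "(\<lambda>n. L2_norm (\<lambda>x. s n x - f x)) \<longlonglongrightarrow> 0" "(\<lambda>n. L2_norm (\<lambda>\<xi>. S n \<xi> - g \<xi>)) \<longlonglongrightarrow> 0"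
  shows "(f, g) \<in> L2_fourier"
proof (rule L2_fourier_cong_left)
  let ?w = "L2_fourier_inv g"
  show w: "(?w, g) \<in> L2_fourier" by (rule L2_fourier_inv[OF assms(3)])
  have "(\<lambda>n. L2_norm (\<lambda>x. s n x - ?w x)) \<longlonglongrightarrow> 0"
    using assms(5) by (simp only: L2_fourier_norm[OF L2_fourier_diff[OF assms(1) w]])
  then show "AE x in lborel. ?w x = f x"
    by (rule L2_limit_unique[OF L2_fourierD(1)[OF assms(1)] L2_fourierD(1)[OF w] assms(2) _ assms(4)])
qed fact

text \<open>\<open>L2_series\<close> takes series over the natural numbers, so the double sum over k
  and j has to be enumerated; nonnegativity makes the order irrelevant.\<close>

lemma summable_prod_decode_mult:
  fixes p q :: "nat \<Rightarrow> real"
  assumes "summable p" "summable q" "\<And>k. 0 \<le> p k" "\<And>j. 0 \<le> q j"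
  shows "summable (\<lambda>n. case prod_decode n of (k, j) \<Rightarrow> p k * q j)"
proof -
  have p: "p summable_on UNIV" and q: "(q has_sum suminf q) UNIV"
    using assms by (auto simp: summable_on_UNIV_nonneg_real_iff intro!: norm_summable_imp_has_sum summable_sums)
  have "(\<lambda>(k, j). p k * q j) summable_on (SIGMA k:UNIV. UNIV)"
    by (rule summable_on_SigmaI[where g = "\<lambda>k. p k * suminf q"])
      (use assms p q in \<open>auto intro!: has_sum_cmult_right summable_on_cmult_left\<close>)
  then have "(\<lambda>n. (\<lambda>(k, j). p k * q j) (prod_decode n)) summable_on UNIV"
    by (subst summable_on_reindex_bij_betw[OF bij_prod_decode]) simp
  then show ?thesis by (rule summable_on_imp_summable)
qed

text \<open>
  Where \<open>k \<le> m < k + 1\<close>, the second factor of \<open>exp (i t m) = exp (i t k) exp (i t (m - k))\<close> is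
  expanded into its power series; the pairs \<open>(k, j)\<close> are enumerated by \<^const>\<open>prod_decode\<close>.
\<close>

definition evolution_coeff :: "nat \<Rightarrow> real \<Rightarrow> complex" where
  "evolution_coeff n t = (case prod_decode n of (k, j) \<Rightarrow>
     exp (\<i> * complex_of_real (t * real k)) * ((\<i> * complex_of_real t) ^ j / fact j))"

definition evolution_piece :: "nat \<Rightarrow> real \<Rightarrow> complex" where
  "evolution_piece n l = (case prod_decode n of (k, j) \<Rightarrow>
     indicator {real k..<real k + 1} l * complex_of_real (l - real k) ^ j)"

lemma evolution_piece_measurable [measurable]: "evolution_piece n \<in> borel_measurable borel"
proof -
  obtain k j where "prod_decode n = (k, j)" by fastforce
  then have "evolution_piece n = (\<lambda>l. indicator {real k..<real k + 1} l * complex_of_real (l - real k) ^ j)"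
    by (auto simp: evolution_piece_def)
  then show ?thesis by simp
qed

lemma cmod_evolution_coeff:
  assumes "prod_decode n = (k, j)"
  shows "cmod (evolution_coeff n t) = \<bar>t\<bar> ^ j / fact j"
  using assms
  by (simp add: evolution_coeff_def norm_mult norm_divide norm_power norm_exp_i_times[of "t * real k", simplified])

text \<open>On the support l is at least k, so the quotient is at least 1, while the power of l - k
  is at most 1. Localization near k is traded for decay in k, uniformly in j, at the price of the
  weight (1 + l)^2.\<close>

lemma cmod_evolution_piece:
  assumes "prod_decode n = (k, j)"
  shows "cmod (evolution_piece n l) \<le> (1 + l)\<^sup>2 / (1 + real k)\<^sup>2"
proof (cases "l \<in> {real k..<real k + 1}")
  case True
  then have "\<bar>l - real k\<bar> ^ j \<le> 1" by (intro power_le_one) auto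
  moreover have "1 \<le> (1 + l)\<^sup>2 / (1 + real k)\<^sup>2"
    using True by (subst le_divide_eq_1_pos) (auto intro!: power_mono)
  ultimately have "\<bar>l - real k\<bar> ^ j \<le> (1 + l)\<^sup>2 / (1 + real k)\<^sup>2"
    by (rule order_trans)
  moreover have "cmod (evolution_piece n l) = \<bar>l - real k\<bar> ^ j"
    using True assms unfolding evolution_piece_def
    by (simp add: norm_power del: of_real_diff)
  ultimately show ?thesis by simp
qed (use assms in \<open>simp add: evolution_piece_def\<close>)

text \<open>Exactly one of the half-open intervals contains l, that of k = floor l, and its terms
  form the exponential series of i t (l - k). With unordered sums (\<open>has_sum\<close>) the
  passage from pairs to their enumeration is a mere reindexing.\<close>

lemma evolution_sums:
  assumes "0 \<le> l"
  shows "(\<lambda>n. evolution_coeff n t * evolution_piece n l) sums exp (\<i> * complex_of_real (t * l))"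
proof -
  define k where "k = nat \<lfloor>l\<rfloor>"
  have k: "real k \<le> l" "l < real k + 1"
    using assms unfolding k_def by linarith+
  let ?z = "\<i> * complex_of_real t * complex_of_real (l - real k)"
  define T where "T = (\<lambda>(k', j). exp (\<i> * complex_of_real (t * real k')) * ((\<i> * complex_of_real t) ^ j / fact j)
    * (indicator {real k'..<real k' + 1} l * complex_of_real (l - real k') ^ j))"
  have "((\<lambda>j. ?z ^ j /\<^sub>R fact j) has_sum exp ?z) UNIV"
    by (rule norm_summable_imp_has_sum[OF summable_norm_exp exp_converges])
  then have "((\<lambda>j. exp (\<i> * complex_of_real (t * real k)) * (?z ^ j /\<^sub>R fact j))
      has_sum exp (\<i> * complex_of_real (t * real k)) * exp ?z) UNIV"
    by (rule has_sum_cmult_right)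
  moreover have "exp (\<i> * complex_of_real (t * real k)) * exp ?z = exp (\<i> * complex_of_real (t * l))"
    unfolding exp_add[symmetric] by (simp add: algebra_simps)
  moreover have "exp (\<i> * complex_of_real (t * real k)) * (?z ^ j /\<^sub>R fact j) = T (k, j)" for j
    using k unfolding T_def power_mult_distrib
    by (simp add: scaleR_conv_of_real divide_inverse mult_ac del: of_real_diff)
  ultimately have "((\<lambda>j. T (k, j)) has_sum exp (\<i> * complex_of_real (t * l))) UNIV"
    by simp
  moreover have "bij_betw (Pair k) UNIV ({k} \<times> (UNIV :: nat set))"
    by (auto simp: bij_betw_def inj_on_def)
  ultimately have "(T has_sum exp (\<i> * complex_of_real (t * l))) ({k} \<times> UNIV)"
    using has_sum_reindex_bij_betw[of "Pair k" UNIV _ T] by simp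
  then have "(T has_sum exp (\<i> * complex_of_real (t * l))) UNIV"
  proof (rule has_sum_cong_neutral[THEN iffD1, rotated 3])
    fix p :: "nat \<times> nat" assume "p \<in> UNIV - {k} \<times> UNIV"
    then obtain k' j where p: "p = (k', j)" "k' \<noteq> k" by (cases p) auto
    then have "l \<notin> {real k'..<real k' + 1}" using k by auto
    then show "T p = 0" by (simp add: T_def p)
  qed auto
  then have "((\<lambda>n. T (prod_decode n)) has_sum exp (\<i> * complex_of_real (t * l))) UNIV"
    by (subst has_sum_reindex_bij_betw[OF bij_prod_decode])
  moreover have "T (prod_decode n) = evolution_coeff n t * evolution_piece n l" for n
    by (simp add: T_def evolution_coeff_def evolution_piece_def split: prod.split)
  ultimately show ?thesis by (auto dest: has_sum_imp_sums)
qed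

text \<open>The modulus of a coefficient is nondecreasing in |t|, so its value at T dominates on
  (-T, T) and the Weierstrass test applies. With T restricted to natural numbers the hypothesis is a
  countable family, which can hold outside one null set.\<close>

lemma evolution_continuous:
  assumes sum: "\<And>T :: nat. summable (\<lambda>n. cmod (evolution_coeff n (real T) * c n))"
  shows "continuous_on UNIV (\<lambda>t. \<Sum>n. evolution_coeff n t * c n)"
proof -
  have cont: "continuous_on A (evolution_coeff n)" for A n
  proof -
    obtain k j where n: "prod_decode n = (k, j)" by fastforce
    show ?thesis
      unfolding evolution_coeff_def[abs_def] n prod.case by (intro continuous_intros) simp_all
  qed
  have "isCont (\<lambda>t. \<Sum>n. evolution_coeff n t * c n) t" for t
  proof -
    obtain T :: nat where T: "\<bar>t\<bar> < real T" using reals_Archimedean2 by blast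
    let ?A = "{- real T<..<real T}"
    have "cmod (evolution_coeff n t * c n) \<le> cmod (evolution_coeff n (real T) * c n)" if "t \<in> ?A" for t n
    proof -
      obtain k j where n: "prod_decode n = (k, j)" by fastforce
      show ?thesis
        unfolding norm_mult cmod_evolution_coeff[OF n]
        by (intro mult_right_mono divide_right_mono power_mono) (use that in auto)
    qed
    then have "uniform_limit ?A (\<lambda>N t. \<Sum>n<N. evolution_coeff n t * c n)
        (\<lambda>t. \<Sum>n. evolution_coeff n t * c n) sequentially"
      by (rule Weierstrass_m_test[OF _ sum])
    then have "continuous_on ?A (\<lambda>t. \<Sum>n. evolution_coeff n t * c n)"
      by (rule uniform_limit_theorem[rotated]) (auto intro!: always_eventually continuous_intros cont)
    then show ?thesis
      using T by (simp add: continuous_on_eq_continuous_at abs_less_iff minus_less_iff)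
  qed
  then show ?thesis by (simp add: continuous_on_eq_continuous_at)
qed

text \<open>Hypothesis D puts f in the domain of (1 + A)^2, where A is the multiplier m. The inverse
  transforms h n of the pieces of F are fixed before t. \<open>L2_series\<close> is used twice, with
  equal norms: on the Fourier side the sum is recognised pointwise as exp(i t m) F, on the x side it
  defines u t, and closedness of the graph joins the two.\<close>

lemma fourier_multiplier_evolution_continuous:
  fixes m :: "'a::euclidean_space \<Rightarrow> real"
  assumes m [measurable]: "m \<in> borel_measurable borel" and m0: "\<And>\<xi>. 0 \<le> m \<xi>"
    and f: "(f, F) \<in> L2_fourier" and D: "(\<lambda>\<xi>. complex_of_real ((1 + m \<xi>)\<^sup>2) * F \<xi>) \<in> L2"
  shows "\<exists>u. (\<forall>t. (f, u t) \<in> fourier_multiplier (\<lambda>\<xi>. exp (\<i> * complex_of_real (t * m \<xi>))))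
    \<and> (AE x in lborel. continuous_on UNIV (\<lambda>t. u t x))"
proof -
  note F = L2_fourierD(2)[OF f]
  have [measurable]: "F \<in> borel_measurable borel" by (rule L2_measurable[OF F])
  define C where "C = L2_norm (\<lambda>\<xi>. complex_of_real ((1 + m \<xi>)\<^sup>2) * F \<xi>)"
  define g where "g n \<xi> = evolution_piece n (m \<xi>) * F \<xi>" for n \<xi>
  have g_bound: "cmod (g n \<xi>) \<le> 1 / (1 + real k)\<^sup>2 * cmod (complex_of_real ((1 + m \<xi>)\<^sup>2) * F \<xi>)"
    if "prod_decode n = (k, j)" for n k j \<xi>
    using mult_right_mono[OF cmod_evolution_piece[OF that, of "m \<xi>"] norm_ge_zero[of "F \<xi>"]]
    by (simp add: g_def norm_mult norm_power del: of_real_add of_real_power)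
  have g_meas: "g n \<in> borel_measurable borel" for n unfolding g_def[abs_def] by measurable
  have g: "g n \<in> L2" for n
  proof -
    obtain k j where "prod_decode n = (k, j)" by fastforce
    then show ?thesis by (intro L2_bound[OF D g_meas, where C = "1 / (1 + real k)\<^sup>2"] AE_I2 g_bound)
  qed
  have g_norm: "L2_norm (g n) \<le> 1 / (1 + real k)\<^sup>2 * C" if "prod_decode n = (k, j)" for n k j
    unfolding C_def by (rule L2_norm_bound[OF D g_meas]) (use g_bound[OF that] in auto)
  define h where "h n = L2_fourier_inv (g n)" for n
  have hg: "(h n, g n) \<in> L2_fourier" for n unfolding h_def by (rule L2_fourier_inv[OF g])
  note h = L2_fourierD(1)[OF hg]
  have sum: "summable (\<lambda>n. L2_norm (\<lambda>\<xi>. evolution_coeff n t * g n \<xi>))" for t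
  proof (rule summable_comparison_test)
    have "summable (\<lambda>k. inverse (real (Suc k) ^ 2))"
      by (rule iffD2[OF summable_Suc_iff inverse_power_summable]) simp
    then have "summable (\<lambda>k. 1 / (1 + real k)\<^sup>2)"
      by (simp only: of_nat_Suc inverse_eq_divide)
    then have "summable (\<lambda>k. 1 / (1 + real k)\<^sup>2 * C)" by (rule summable_mult2)
    moreover have "summable (\<lambda>j. \<bar>t\<bar> ^ j / fact j)"
      using summable_exp[of "\<bar>t\<bar>"] by (simp add: divide_inverse mult.commute)
    ultimately show "summable (\<lambda>n. case prod_decode n of (k, j) \<Rightarrow> 1 / (1 + real k)\<^sup>2 * C * (\<bar>t\<bar> ^ j / fact j))"
      by (rule summable_prod_decode_mult) (auto simp: C_def)
    show "\<exists>N. \<forall>n\<ge>N. norm (L2_norm (\<lambda>\<xi>. evolution_coeff n t * g n \<xi>))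
        \<le> (case prod_decode n of (k, j) \<Rightarrow> 1 / (1 + real k)\<^sup>2 * C * (\<bar>t\<bar> ^ j / fact j))"
    proof (intro exI allI impI)
      fix n
      obtain k j where n: "prod_decode n = (k, j)" by fastforce
      show "norm (L2_norm (\<lambda>\<xi>. evolution_coeff n t * g n \<xi>))
        \<le> (case prod_decode n of (k, j) \<Rightarrow> 1 / (1 + real k)\<^sup>2 * C * (\<bar>t\<bar> ^ j / fact j))"
        using mult_right_mono[OF g_norm[OF n], of "\<bar>t\<bar> ^ j / fact j"]
        by (simp add: n L2_norm_scale cmod_evolution_coeff[OF n] mult.commute)
    qed
  qed
  have sum_h: "summable (\<lambda>n. L2_norm (\<lambda>x. evolution_coeff n t * h n x))" for t
    using sum[of t] by (simp add: L2_norm_scale L2_fourier_norm[OF hg])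
  \<comment> \<open>One formula for every t and every x. Where the series diverges,
    \<open>suminf\<close> returns some default value, which is harmless on a null set.\<close>
  define u where "u t x = (\<Sum>n. evolution_coeff n t * h n x)" for t x
  have "(u t, \<lambda>\<xi>. exp (\<i> * complex_of_real (t * m \<xi>)) * F \<xi>) \<in> L2_fourier" for t
  proof (rule L2_fourier_closed)
    have "(\<Sum>n. evolution_coeff n t * g n \<xi>) = exp (\<i> * complex_of_real (t * m \<xi>)) * F \<xi>" for \<xi>
      using sums_mult2[OF evolution_sums[OF m0], of t \<xi> "F \<xi>"]
      by (simp add: g_def mult.assoc sums_iff)
    then show "(\<lambda>\<xi>. exp (\<i> * complex_of_real (t * m \<xi>)) * F \<xi>) \<in> L2"
      "(\<lambda>N. L2_norm (\<lambda>\<xi>. (\<Sum>n<N. evolution_coeff n t * g n \<xi>) - exp (\<i> * complex_of_real (t * m \<xi>)) * F \<xi>)) \<longlonglongrightarrow> 0"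
      using L2_series(2,3)[OF L2_scale[OF g] sum[of t]] by simp_all
    show "u t \<in> L2" "(\<lambda>N. L2_norm (\<lambda>x. (\<Sum>n<N. evolution_coeff n t * h n x) - u t x)) \<longlonglongrightarrow> 0"
      unfolding u_def using L2_series(2,3)[OF L2_scale[OF h] sum_h[of t]] by simp_all
    show "(\<lambda>x. \<Sum>n<N. evolution_coeff n t * h n x, \<lambda>\<xi>. \<Sum>n<N. evolution_coeff n t * g n \<xi>) \<in> L2_fourier" for N
      by (intro L2_fourier_sum L2_fourier_scale hg)
  qed
  then have "(f, u t) \<in> fourier_multiplier (\<lambda>\<xi>. exp (\<i> * complex_of_real (t * m \<xi>)))" for t
    using f by (auto simp: fourier_multiplier_def)
  moreover have "AE x in lborel. continuous_on UNIV (\<lambda>t. u t x)"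
  proof -
    \<comment> \<open>Countably many null sets, one for each natural T, are united before any real t
      is considered.\<close>
    have "AE x in lborel. \<forall>T :: nat. summable (\<lambda>n. cmod (evolution_coeff n (real T) * h n x))"
      unfolding AE_all_countable by (intro allI L2_series(1) L2_scale h sum_h)
    then show ?thesis
      unfolding u_def by eventually_elim (rule evolution_continuous, simp)
  qed
  ultimately show ?thesis by blast
qed

theorem corollary1p7:
  fixes a s :: real and f :: "real ^ 'n \<Rightarrow> complex"
  assumes "0 < a" and "a < 2" and "s > 2 * a"
    and "f \<in> sobolev s"
  shows "\<exists>u :: real \<Rightarrow> real ^ 'n \<Rightarrow> complex.
           (\<forall>t. (f, u t) \<in> unitary_group (frac_laplacian a) t) \<and>
           (AE x in lborel. continuous_on UNIV (\<lambda>t. u t x)) \<and>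
           (AE x in lborel. ((\<lambda>t. u t x) \<longlongrightarrow> f x) (at 0))"
proof -
  let ?m = "\<lambda>\<xi> :: real ^ 'n. norm \<xi> powr a"
  obtain F where F: "(f, F) \<in> L2_fourier"
    and S: "(\<lambda>\<xi>. complex_of_real ((1 + (norm \<xi>)\<^sup>2) powr (s / 2)) * F \<xi>) \<in> L2"
    using assms(4) by (auto simp: sobolev_def)
  have [measurable]: "F \<in> borel_measurable borel" by (rule L2_measurable[OF L2_fourierD(2)[OF F]])
  \<comment> \<open>With r = 1 + |xi|^2, both 1 and |xi|^a are at most r^(a/2), so the square of
    their sum is at most 4 r^a; and s > 2 a gives a \<le> s/2.\<close>
  have le: "(1 + ?m \<xi>)\<^sup>2 \<le> 4 * (1 + (norm \<xi>)\<^sup>2) powr (s / 2)" for \<xi>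
  proof -
    let ?r = "1 + (norm \<xi>)\<^sup>2"
    have r: "1 \<le> ?r" by simp
    have "norm \<xi> \<le> sqrt ?r" by (rule real_le_rsqrt) simp
    then have "?m \<xi> \<le> sqrt ?r powr a"
      using assms(1) by (intro powr_mono2) auto
    also have "\<dots> = ?r powr (a / 2)"
      by (simp add: powr_half_sqrt[symmetric] powr_powr)
    finally have "1 + ?m \<xi> \<le> 2 * ?r powr (a / 2)"
      using ge_one_powr_ge_zero[OF r, of "a / 2"] assms(1) by simp
    then have "(1 + ?m \<xi>)\<^sup>2 \<le> (2 * ?r powr (a / 2))\<^sup>2"
      by (intro power_mono) auto
    also have "\<dots> = 4 * ?r powr a"
      by (simp add: power_mult_distrib power2_eq_square powr_add[symmetric])
    also have "\<dots> \<le> 4 * ?r powr (s / 2)"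
      using assms(3) r by (intro mult_left_mono powr_mono) auto
    finally show ?thesis .
  qed
  have D: "(\<lambda>\<xi>. complex_of_real ((1 + ?m \<xi>)\<^sup>2) * F \<xi>) \<in> L2"
  proof (rule L2_bound[OF S, where C = 4], measurable, rule AE_I2)
    fix \<xi>
    show "cmod (complex_of_real ((1 + ?m \<xi>)\<^sup>2) * F \<xi>)
        \<le> 4 * cmod (complex_of_real ((1 + (norm \<xi>)\<^sup>2) powr (s / 2)) * F \<xi>)"
      using mult_right_mono[OF le norm_ge_zero] unfolding norm_mult norm_of_real by (simp add: mult.assoc)
  qed
  obtain u where u: "\<And>t. (f, u t) \<in> fourier_multiplier (\<lambda>\<xi>. exp (\<i> * complex_of_real (t * ?m \<xi>)))"
    and cont: "AE x in lborel. continuous_on UNIV (\<lambda>t. u t x)"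
    using fourier_multiplier_evolution_continuous[OF _ _ F D] by auto
  have "(f, u t) \<in> unitary_group (frac_laplacian a) t" for t
    unfolding unitary_group_def frac_laplacian_def
    by (rule functional_calculus_fourier_multiplier) (use u in auto)
  \<comment> \<open>At t = 0 the multiplier is 1, so u 0 and f have the same transform. The limit
    has to be the value of the given f rather than of the representative u 0, which costs one more
    null set.\<close>
  moreover have "AE x in lborel. u 0 x = f x"
    using u[of 0] by (auto simp: fourier_multiplier_def intro: L2_fourier_injective)
  then have "AE x in lborel. ((\<lambda>t. u t x) \<longlongrightarrow> f x) (at 0)"
    using cont
  proof eventually_elim
    case (elim x)
    then have "isCont (\<lambda>t. u t x) 0" by (simp add: continuous_on_eq_continuous_at)
    then show ?case using elim(1) by (simp add: isCont_def)
  qed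
  ultimately show ?thesis using cont by blast
qed

end
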